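(* If $(\mathcal G,z)$ is a non-trivial flow-critical tame canvas, then every vertex of $\mathcal G$ other than $z$ has degree at most $\deg(z)-2$.
   Context: Graphs are finite, loopless, and may have parallel edges. A $\mathbb{Z}_3$-boundary of a graph $G$ is a map $\beta:V(G)\to\mathbb{Z}_3$ with $\sum_{v\in V(C)}\beta(v)=0$ for every component $C$ of $G$; $\mathcal G=(G,\beta)$ is then a $\mathbb{Z}_3$-bordered graph (its vertices, edges, degrees are those of $G$). A nowhere-zero flow in $(G,\beta)$ is an orientation of $G$ with $\deg^+(v)-\deg^-(v)\equiv\beta(v)\pmod 3$ for every $v$. For $A\subseteq V(G)$, $\deg(A)$ is the number of edges with exactly one end in $A$, $\beta(A)=\sum_{v\in A}\beta(v)$, and $|\tau(A)|$ equals $0$ if $\deg(A)$ is even and $\beta(A)=0$; $2$ if $\deg(A)$ is even and $\beta(A)\neq 0$; $3$ if $\deg(A)$ is odd and $\beta(A)=0$; $1$ if $\deg(A)$ is odd and $\beta(A)\neq 0$. Write $\tau(v)$ for $\tau(\{v\})$. For a partition $\mathcal P$ of $V(G)$, $G/\mathcal P$ is obtained by identifying each part into one vertex and deleting loops, $\beta/\mathcal P$ gives each new vertex the sum of $\beta$ over its part, and $\mathcal G/\mathcal P=(G/\mathcal P,\beta/\mathcal P)$; $\mathcal P$ is non-trivial if some part has at least two vertices. A canvas $(\mathcal G,z)$ is a $\mathbb{Z}_3$-bordered graph with a distinguished vertex $z$ (the tip); it is non-trivial if it has at least three vertices. A tip preflow is an orientation $\psi$ of the edges incident with $z$ such that (counting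 in $\psi$) $\deg^+(z)-\deg^-(z)\equiv \beta(z)\pmod 3$; it extends to a nowhere-zero flow if some nowhere-zero flow agrees with $\psi$ on the edges incident with $z$. A partition $\mathcal P$ is tip-respecting if $\{z\}$ is a part; then $(\mathcal G/\mathcal P,z)$ is a canvas whose tip preflows are the same as those of $(\mathcal G,z)$. The canvas is flow-critical if for every non-trivial tip-respecting partition $\mathcal P$ there is a tip preflow that extends to a nowhere-zero flow in $\mathcal G/\mathcal P$ but not in $\mathcal G$. The canvas is tame if $\deg(v)\ge 4+|\tau(v)|$ for every vertex $v\neq z$. *)

theory Defs
  imports Main "HOL-Library.Numeral_Type" "HOL-Library.Disjoint_Sets"
begin

record ('v, 'e) multigraph =
  verts :: "'v set"
  edges :: "'e set"
  ends :: "'e \<Rightarrow> 'v set"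

definition wf_multigraph :: "('v, 'e) multigraph \<Rightarrow> bool" where
  "wf_multigraph G \<longleftrightarrow>
     finite (verts G) \<and> finite (edges G) \<and>
     (\<forall>e \<in> edges G. ends G e \<subseteq> verts G \<and> card (ends G e) = 2)"

definition incident_edges :: "('v, 'e) multigraph \<Rightarrow> 'v \<Rightarrow> 'e set" where
  "incident_edges G v = {e \<in> edges G. v \<in> ends G e}"

definition degree :: "('v, 'e) multigraph \<Rightarrow> 'v \<Rightarrow> nat" where
  "degree G v = card (incident_edges G v)"

definition set_degree :: "('v, 'e) multigraph \<Rightarrow> 'v set \<Rightarrow> nat" where
  "set_degree G A = card {e \<in> edges G. card (ends G e \<inter> A) = 1}"

definition adjacency :: "('v, 'e) multigraph \<Rightarrow> ('v \<times> 'v) set" where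
  "adjacency G = {(u, v). \<exists>e \<in> edges G. ends G e = {u, v}}"

definition components :: "('v, 'e) multigraph \<Rightarrow> 'v set set" where
  "components G = (\<lambda>v. (adjacency G)\<^sup>* `` {v}) ` verts G"

text \<open>The numeral type \<open>3\<close> is the ring of integers modulo 3.\<close>
type_synonym Z3 = "3"

definition Z3_boundary :: "('v, 'e) multigraph \<Rightarrow> ('v \<Rightarrow> Z3) \<Rightarrow> bool" where
  "Z3_boundary G \<beta> \<longleftrightarrow> (\<forall>C \<in> components G. sum \<beta> C = 0)"

definition Z3_bordered_graph :: "('v, 'e) multigraph \<Rightarrow> ('v \<Rightarrow> Z3) \<Rightarrow> bool" where
  "Z3_bordered_graph G \<beta> \<longleftrightarrow> wf_multigraph G \<and> Z3_boundary G \<beta>"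

text \<open>
  An orientation of a set \<open>F\<close> of edges is given by a function \<open>h\<close> assigning to each
  edge of \<open>F\<close> its head; its values outside \<open>F\<close> are irrelevant.
\<close>
definition orientation_on :: "('v, 'e) multigraph \<Rightarrow> 'e set \<Rightarrow> ('e \<Rightarrow> 'v) \<Rightarrow> bool" where
  "orientation_on G F h \<longleftrightarrow> (\<forall>e \<in> F. h e \<in> ends G e)"

definition outdegree :: "('v, 'e) multigraph \<Rightarrow> ('e \<Rightarrow> 'v) \<Rightarrow> 'v \<Rightarrow> nat" where
  "outdegree G h v = card {e \<in> incident_edges G v. h e \<noteq> v}"

definition indegree :: "('v, 'e) multigraph \<Rightarrow> ('e \<Rightarrow> 'v) \<Rightarrow> 'v \<Rightarrow> nat" where
  "indegree G h v = card {e \<in> incident_edges G v. h e = v}"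

definition balanced_at ::
  "('v, 'e) multigraph \<Rightarrow> ('v \<Rightarrow> Z3) \<Rightarrow> ('e \<Rightarrow> 'v) \<Rightarrow> 'v \<Rightarrow> bool" where
  "balanced_at G \<beta> h v \<longleftrightarrow> of_nat (outdegree G h v) - of_nat (indegree G h v) = \<beta> v"

definition nowhere_zero_flow ::
  "('v, 'e) multigraph \<Rightarrow> ('v \<Rightarrow> Z3) \<Rightarrow> ('e \<Rightarrow> 'v) \<Rightarrow> bool" where
  "nowhere_zero_flow G \<beta> h \<longleftrightarrow>
     orientation_on G (edges G) h \<and> (\<forall>v \<in> verts G. balanced_at G \<beta> h v)"

definition abs_tau :: "('v, 'e) multigraph \<Rightarrow> ('v \<Rightarrow> Z3) \<Rightarrow> 'v set \<Rightarrow> nat" where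
  "abs_tau G \<beta> A =
     (if even (set_degree G A)
      then (if sum \<beta> A = 0 then 0 else 2)
      else (if sum \<beta> A = 0 then 3 else 1))"

definition part_of :: "'v set set \<Rightarrow> 'v \<Rightarrow> 'v set" where
  "part_of P v = (THE p. p \<in> P \<and> v \<in> p)"

text \<open>The vertices of \<open>G / P\<close> are the parts themselves; edges keep their names.\<close>
definition contract :: "('v, 'e) multigraph \<Rightarrow> 'v set set \<Rightarrow> ('v set, 'e) multigraph" where
  "contract G P =
     \<lparr>verts = P,
      edges = {e \<in> edges G. \<not> (\<exists>p \<in> P. ends G e \<subseteq> p)},
      ends = (\<lambda>e. part_of P ` ends G e)\<rparr>"

definition contract_boundary :: "('v \<Rightarrow> Z3) \<Rightarrow> 'v set \<Rightarrow> Z3" where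
  "contract_boundary \<beta> p = sum \<beta> p"

definition contract_orientation :: "'v set set \<Rightarrow> ('e \<Rightarrow> 'v) \<Rightarrow> 'e \<Rightarrow> 'v set" where
  "contract_orientation P h e = part_of P (h e)"

definition nontrivial_partition :: "'v set set \<Rightarrow> bool" where
  "nontrivial_partition P \<longleftrightarrow> (\<exists>p \<in> P. card p \<ge> 2)"

definition canvas :: "('v, 'e) multigraph \<Rightarrow> ('v \<Rightarrow> Z3) \<Rightarrow> 'v \<Rightarrow> bool" where
  "canvas G \<beta> z \<longleftrightarrow> Z3_bordered_graph G \<beta> \<and> z \<in> verts G"

definition nontrivial_canvas :: "('v, 'e) multigraph \<Rightarrow> ('v \<Rightarrow> Z3) \<Rightarrow> 'v \<Rightarrow> bool" where
  "nontrivial_canvas G \<beta> z \<longleftrightarrow> canvas G \<beta> z \<and> card (verts G) \<ge> 3"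

definition tip_preflow ::
  "('v, 'e) multigraph \<Rightarrow> ('v \<Rightarrow> Z3) \<Rightarrow> 'v \<Rightarrow> ('e \<Rightarrow> 'v) \<Rightarrow> bool" where
  "tip_preflow G \<beta> z \<psi> \<longleftrightarrow>
     orientation_on G (incident_edges G z) \<psi> \<and> balanced_at G \<beta> \<psi> z"

definition extends_to_flow ::
  "('v, 'e) multigraph \<Rightarrow> ('v \<Rightarrow> Z3) \<Rightarrow> 'v \<Rightarrow> ('e \<Rightarrow> 'v) \<Rightarrow> bool" where
  "extends_to_flow G \<beta> z \<psi> \<longleftrightarrow>
     (\<exists>h. nowhere_zero_flow G \<beta> h \<and> (\<forall>e \<in> incident_edges G z. h e = \<psi> e))"

definition tip_respecting :: "('v, 'e) multigraph \<Rightarrow> 'v \<Rightarrow> 'v set set \<Rightarrow> bool" where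
  "tip_respecting G z P \<longleftrightarrow> partition_on (verts G) P \<and> {z} \<in> P"

text \<open>
  A tip preflow \<open>\<psi>\<close> is transported to \<open>G / P\<close> by replacing the head of each edge
  by the part containing it; the tip of \<open>G / P\<close> is the part \<open>{z}\<close>.
\<close>
definition flow_critical :: "('v, 'e) multigraph \<Rightarrow> ('v \<Rightarrow> Z3) \<Rightarrow> 'v \<Rightarrow> bool" where
  "flow_critical G \<beta> z \<longleftrightarrow>
     (\<forall>P. tip_respecting G z P \<and> nontrivial_partition P \<longrightarrow>
       (\<exists>\<psi>. tip_preflow G \<beta> z \<psi> \<and>
            extends_to_flow (contract G P) (contract_boundary \<beta>) {z}
              (contract_orientation P \<psi>) \<and>
            \<not> extends_to_flow G \<beta> z \<psi>))"

definition tame :: "('v, 'e) multigraph \<Rightarrow> ('v \<Rightarrow> Z3) \<Rightarrow> 'v \<Rightarrow> bool" where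
  "tame G \<beta> z \<longleftrightarrow> (\<forall>v \<in> verts G - {z}. degree G v \<ge> 4 + abs_tau G \<beta> {v})"

end

theory Submission
  imports Defs
begin

text \<open>
  Fixing a tip preflow turns \<open>G - z\<close> into a graph with a prescribed \<open>Z3\<close>-valued demand at each vertex.
  A vertex of degree \<open>d\<close> in \<open>G - z\<close> with demand \<open>a\<close> is tame only if it has at least
  \<open>tip_demand d a\<close> edges to the tip, and conversely any such number can be realised; so the tip
  edges can be redistributed freely as long as each vertex keeps its \<open>tip_demand\<close>.

  For an unsatisfiable demand all of whose proper contractions are satisfiable, one shows by induction
  on the size that (a) the total tip demand \<open>M\<close> exceeds every full degree by at least 2, and (b) if
  \<open>M = 7\<close> then at most one vertex has full degree at least 5. Applied to vertex subsets, (a) and (b) give lower bounds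
  on cuts. Vertices of full degree 4 are removed by splitting off pairs of edges. If there are none,
  every nontrivial cut has size at least 8. Then every edge whose orientation does not increase the
  tip demand at its ends can be deleted, which forces a common sign on all vertices but the
  violating one, and a vertex of degree 4 can be removed by directing all its edges the same way.
\<close>

section \<open>Flow values and tip demands\<close>

text \<open>Deleting an edge or a vertex need not preserve criticality, so each reduction is
  followed by a passage to some critical contraction, over whose parts there is no control. What
  transfers back are cuts: a part is a vertex set, and its boundary was large before the reduction.
  Hence the bounds are proved for vertex subsets too. The number 6 recurs because
  \<open>full_degree\<close> is at most \<open>max d 6\<close>: a part with boundary at least 6, tip
  edges included, is tame whatever its demand. Splitting off may cost a cut two edges, deleting an
  edge costs one. Statement (b) keeps the induction going. A cut with seven edges and no tip edges
  that drops to five would be untame if its total demand were 0, and (b) excludes this. With all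
  full degrees at least 5, (b) also raises the cut bound from 7 to 8. In a flow-critical canvas the
  bad preflow depends on the partition, so there is no single demand to work with. The transfer to
  canvases therefore uses a local notion in which every subset comes with its own demand.\<close>

lemma Z3_cases: "(a::Z3) = 0 \<or> a = 1 \<or> a = -1"
proof (cases a rule: bit1_cases)
  case (of_int z)
  then have "z = 0 \<or> z = 1 \<or> z = 2" by auto
  then show ?thesis using of_int by auto
qed

lemma Z3_three: "(a::Z3) + a + a = 0"
  using Z3_cases[of a] by auto

lemma Z3_eq_uminus: "(a::Z3) = - a \<longleftrightarrow> a = 0"
  using Z3_cases[of a] by auto

text \<open>\<open>allowed n a\<close> holds iff \<open>n\<close> parallel edges can carry the net flow \<open>a\<close>, each edge carrying \<open>1\<close> or \<open>-1\<close>.\<close>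
definition allowed :: "nat \<Rightarrow> Z3 \<Rightarrow> bool" where
  "allowed n a \<longleftrightarrow> (n = 0 \<longrightarrow> a = 0) \<and> (n = 1 \<longrightarrow> a \<noteq> 0)"

lemma allowed_add: "allowed m a \<Longrightarrow> allowed n b \<Longrightarrow> allowed (m + n) (a + b)"
  unfolding allowed_def by auto

lemma allowed_sum:
  "finite A \<Longrightarrow> (\<And>x. x \<in> A \<Longrightarrow> allowed (n x) (g x)) \<Longrightarrow> allowed (\<Sum>x\<in>A. n x) (\<Sum>x\<in>A. g x)"
  by (induction A rule: finite_induct) (auto simp: allowed_add, simp add: allowed_def)

lemma allowed_uminus [simp]: "allowed n (- a) \<longleftrightarrow> allowed n a"
  unfolding allowed_def by auto

lemma allowed_split:
  assumes "allowed (m + n) a"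
  shows "\<exists>b. allowed m b \<and> allowed n (a - b)"
proof -
  have "\<exists>b\<in>{0,1,-1}. allowed m b \<and> allowed n (a - b)"
    using assms Z3_cases[of a] unfolding allowed_def by (cases "m = 0"; cases "m = 1"; cases "n = 0"; cases "n=1") auto
  then show ?thesis by blast
qed

text \<open>Used to undo a contraction, by sharing out the value of a bundle among its sub-bundles,
  and to orient parallel edges one by one.\<close>

lemma allowed_sum_split:
  "finite A \<Longrightarrow> allowed (\<Sum>x\<in>A. n x) a \<Longrightarrow> \<exists>g. (\<forall>x\<in>A. allowed (n x) (g x)) \<and> (\<Sum>x\<in>A. g x) = a"
proof (induction A arbitrary: a rule: finite_induct)
  case empty
  then show ?case by (simp add: allowed_def)
next
  case (insert y A)
  then obtain b where b: "allowed (n y) b" "allowed (\<Sum>x\<in>A. n x) (a - b)"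
    using allowed_split[of "n y" "\<Sum>x\<in>A. n x" a] by auto
  then obtain g where g: "\<forall>x\<in>A. allowed (n x) (g x)" "(\<Sum>x\<in>A. g x) = a - b"
    using insert by blast
  have "(\<Sum>x\<in>A. (g(y := b)) x) = (\<Sum>x\<in>A. g x)"
    using insert by (intro sum.cong) auto
  then have "(\<forall>x\<in>insert y A. allowed (n x) ((g(y := b)) x)) \<and> (\<Sum>x\<in>insert y A. (g(y := b)) x) = a"
    using insert b g by auto
  then show ?case by blast
qed

text \<open>The least \<open>m\<close> such that \<open>m\<close> edges to the tip can be added and oriented so that a vertex of degree
  \<open>d\<close> with residual demand \<open>a\<close> becomes tame.\<close>
definition tip_demand :: "nat \<Rightarrow> Z3 \<Rightarrow> nat" where
  "tip_demand d a = (if d \<le> 2 then 4 - d else if d = 3 then (if a = 0 then 2 else 1)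
     else if d = 4 then (if a = 0 then 0 else 1) else if d = 5 then (if a = 0 then 1 else 0) else 0)"

definition full_degree :: "nat \<Rightarrow> Z3 \<Rightarrow> nat" where
  "full_degree d a = d + tip_demand d a"

lemma full_degree_ge: "full_degree d a \<ge> 4" "full_degree d a \<ge> d"
  unfolding full_degree_def tip_demand_def by auto

lemma full_degree_le: "full_degree d a \<le> max d 6"
  unfolding full_degree_def tip_demand_def by auto

lemma full_degree_le_5: "d \<le> 5 \<Longrightarrow> d \<noteq> 5 \<or> a \<noteq> 0 \<Longrightarrow> full_degree d a \<le> 5"
  unfolding full_degree_def tip_demand_def by auto

text \<open>Total degree 4 is tame only with boundary value 0, so the \<open>4 - d\<close> tip edges
  must absorb the whole demand.\<close>

lemma full_degree_eq_4: "full_degree d a = 4 \<longleftrightarrow> d \<le> 4 \<and> allowed (4 - d) a"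
  unfolding full_degree_def tip_demand_def allowed_def by auto

text \<open>A removed edge of value \<open>b\<close> can be replaced by one tip edge of the same
  value, so the total degree that is required does not grow.\<close>

lemma full_degree_step:
  assumes "b \<noteq> 0" shows "full_degree d (a + b) \<le> full_degree (Suc d) a"
  using assms Z3_cases[of a] Z3_cases[of b] unfolding full_degree_def tip_demand_def by auto

text \<open>Two or more replacement tip edges carry any value, which is why the demands on the two
  sides are unrelated.\<close>

lemma full_degree_step2: "2 \<le> k \<Longrightarrow> full_degree d b \<le> full_degree (d + k) a"
  unfolding full_degree_def tip_demand_def by auto

lemma full_degree_allowed: "allowed k b \<Longrightarrow> full_degree d (a + b) \<le> full_degree (d + k) a"
proof -
  assume *: "allowed k b"
  consider "k = 0" | "k = 1" | "k \<ge> 2" by linarith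
  then show ?thesis
    by cases (use * full_degree_step[of b d a] full_degree_step2[of k d "a+b" a] in \<open>auto simp: allowed_def\<close>)
qed

section \<open>Demands on weighted graphs and contractions\<close>

definition wgraph :: "('v \<Rightarrow> 'v \<Rightarrow> nat) \<Rightarrow> bool" where
  "wgraph w \<longleftrightarrow> (\<forall>x y. w x y = w y x) \<and> (\<forall>x. w x x = 0)"

definition satisfiable :: "'v set \<Rightarrow> ('v \<Rightarrow> 'v \<Rightarrow> nat) \<Rightarrow> ('v \<Rightarrow> Z3) \<Rightarrow> bool" where
  "satisfiable V w r \<longleftrightarrow> (\<exists>f. (\<forall>x\<in>V. \<forall>y\<in>V. f x y = - f y x \<and> allowed (w x y) (f x y)) \<and>
     (\<forall>x\<in>V. (\<Sum>y\<in>V. f x y) = r x))"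

text \<open>The flow-critical analogue for a subset \<open>A\<close>: some demand on \<open>A\<close>, compatible with the total degrees
  \<open>D\<close> of its vertices, cannot be met inside \<open>A\<close>. For \<open>D = degree G\<close> the demand may depend on \<open>A\<close>.\<close>
definition locally_unsat :: "('v \<Rightarrow> 'v \<Rightarrow> nat) \<Rightarrow> ('v \<Rightarrow> nat) \<Rightarrow> 'v set \<Rightarrow> bool" where
  "locally_unsat w D A \<longleftrightarrow> (\<exists>r. sum r A = 0 \<and> \<not> satisfiable A w r \<and>
     (\<forall>x\<in>A. full_degree (\<Sum>y\<in>A. w x y) (r x) \<le> D x))"

definition critical :: "'v set \<Rightarrow> ('v \<Rightarrow> 'v \<Rightarrow> nat) \<Rightarrow> ('v \<Rightarrow> Z3) \<Rightarrow> bool" where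
  "critical V w r \<longleftrightarrow> finite V \<and> wgraph w \<and> sum r V = 0 \<and> \<not> satisfiable V w r \<and>
     (\<forall>A. A \<subset> V \<longrightarrow> 2 \<le> card A \<longrightarrow> locally_unsat w (\<lambda>x. full_degree (\<Sum>y\<in>V. w x y) (r x)) A)"

text \<open>Parts are named through a map into the vertex type itself rather than as sets, so a
  contraction lives over the same type and the induction on size applies to it.\<close>

definition contract_weight :: "('v \<Rightarrow> 'v) \<Rightarrow> 'v set \<Rightarrow> ('v \<Rightarrow> 'v \<Rightarrow> nat) \<Rightarrow> 'v \<Rightarrow> 'v \<Rightarrow> nat" where
  "contract_weight p V w a b =
     (if a = b then 0 else \<Sum>x\<in>{x \<in> V. p x = a}. \<Sum>y\<in>{y \<in> V. p y = b}. w x y)"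

definition contract_demand :: "('v \<Rightarrow> 'v) \<Rightarrow> 'v set \<Rightarrow> ('v \<Rightarrow> Z3) \<Rightarrow> 'v \<Rightarrow> Z3" where
  "contract_demand p V r a = (\<Sum>x\<in>{x \<in> V. p x = a}. r x)"

lemma wgraph_contract_weight: "wgraph w \<Longrightarrow> wgraph (contract_weight p V w)"
  unfolding wgraph_def contract_weight_def
  by (auto, subst sum.swap, simp)

lemma satisfiable_cong:
  assumes "\<And>x y. x \<in> V \<Longrightarrow> y \<in> V \<Longrightarrow> w x y = w' x y" "\<And>x. x \<in> V \<Longrightarrow> r x = r' x"
  shows "satisfiable V w r \<longleftrightarrow> satisfiable V w' r'"
  unfolding satisfiable_def using assms by simp

lemma sum_diff_split:
  fixes g :: "'a \<Rightarrow> 'b::comm_monoid_add"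
  assumes "finite V" "A \<subseteq> V" shows "sum g V = sum g A + sum g (V - A)"
  using assms by (metis add.commute sum.subset_diff)

lemma contract_weight_comp:
  assumes "finite V"
  shows "contract_weight q (p ` V) (contract_weight p V w) = contract_weight (q \<circ> p) V w"
proof (intro ext)
  fix a b
  show "contract_weight q (p ` V) (contract_weight p V w) a b = contract_weight (q \<circ> p) V w a b"
  proof (cases "a = b")
    case True then show ?thesis by (simp add: contract_weight_def)
  next
    case False
    have fib: "(\<Sum>a'\<in>{x \<in> p ` V. q x = c}. \<Sum>x\<in>{x \<in> V. p x = a'}. h x) = (\<Sum>x\<in>{x \<in> V. q (p x) = c}. h x)"
      for c and h :: "'a \<Rightarrow> nat"
    proof -
      have "(\<Sum>a'\<in>{x \<in> p ` V. q x = c}. \<Sum>x\<in>{x \<in> V. p x = a'}. h x) =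
        (\<Sum>a'\<in>{x \<in> p ` V. q x = c}. \<Sum>x\<in>{x \<in> {x \<in> V. q (p x) = c}. p x = a'}. h x)"
        by (intro sum.cong) auto
      also have "\<dots> = (\<Sum>x\<in>{x \<in> V. q (p x) = c}. h x)"
        using assms by (intro sum.group) auto
      finally show ?thesis .
    qed
    have "contract_weight q (p ` V) (contract_weight p V w) a b =
      (\<Sum>a'\<in>{x \<in> p ` V. q x = a}. \<Sum>b'\<in>{y \<in> p ` V. q y = b}.
         \<Sum>x\<in>{x \<in> V. p x = a'}. \<Sum>y\<in>{y \<in> V. p y = b'}. w x y)"
      using False unfolding contract_weight_def by (auto intro!: sum.cong)
    also have "\<dots> = (\<Sum>a'\<in>{x \<in> p ` V. q x = a}. \<Sum>x\<in>{x \<in> V. p x = a'}.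
         \<Sum>b'\<in>{y \<in> p ` V. q y = b}. \<Sum>y\<in>{y \<in> V. p y = b'}. w x y)"
      by (intro sum.cong refl sum.swap)
    also have "\<dots> = contract_weight (q \<circ> p) V w a b"
      using False by (simp add: fib contract_weight_def)
    finally show ?thesis .
  qed
qed

lemma contract_demand_comp:
  assumes "finite V"
  shows "contract_demand q (p ` V) (contract_demand p V r) = contract_demand (q \<circ> p) V r"
proof (intro ext)
  fix c
  have "contract_demand q (p ` V) (contract_demand p V r) c =
        (\<Sum>a'\<in>{x \<in> p ` V. q x = c}. \<Sum>x\<in>{x \<in> {x \<in> V. q (p x) = c}. p x = a'}. r x)"
    unfolding contract_demand_def by (intro sum.cong) auto
  also have "\<dots> = (\<Sum>x\<in>{x \<in> V. q (p x) = c}. r x)"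
    using assms by (intro sum.group) auto
  finally show "contract_demand q (p ` V) (contract_demand p V r) c = contract_demand (q \<circ> p) V r c"
    by (simp add: contract_demand_def)
qed

lemma sum_contract_demand: "finite V \<Longrightarrow> sum (contract_demand p V r) (p ` V) = sum r V"
  unfolding contract_demand_def by (intro sum.group) auto

text \<open>In a flow on the graph with \<open>A\<close> collapsed to \<open>a\<close>, the values
  towards \<open>a\<close> are shared out among the vertices of \<open>A\<close>. This leaves a
  residual demand on \<open>A\<close>; if it could be met inside \<open>A\<close>, the two flows
  would glue to a flow on \<open>V\<close>. Full degrees do not grow because boundary edges can be
  replaced by tip edges.\<close>

lemma locally_unsat_of_collapse:
  fixes w :: "'v \<Rightarrow> 'v \<Rightarrow> nat"
  assumes fin: "finite V" and w: "wgraph w" and unsat: "\<not> satisfiable V w r"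
    and A: "A \<subseteq> V" "a \<in> A"
    and sat: "satisfiable (insert a (V - A)) w' r'"
    and w'1: "\<And>x y. x \<in> V - A \<Longrightarrow> y \<in> V - A \<Longrightarrow> w' x y = w x y"
    and w'2: "\<And>x. x \<in> V - A \<Longrightarrow> w' x a = (\<Sum>y\<in>A. w x y)"
    and r'1: "\<And>x. x \<in> V - A \<Longrightarrow> r' x = r x" and r'2: "r' a = sum r A"
  shows "locally_unsat w (\<lambda>x. full_degree (\<Sum>y\<in>V. w x y) (r x)) A"
proof -
  have finA: "finite A" "finite (V - A)" using fin A finite_subset by auto
  have wsym: "w x y = w y x" for x y using w by (simp add: wgraph_def)
  obtain f where f: "\<And>x y. x \<in> insert a (V - A) \<Longrightarrow> y \<in> insert a (V - A) \<Longrightarrow> f x y = - f y x"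
    "\<And>x y. x \<in> insert a (V - A) \<Longrightarrow> y \<in> insert a (V - A) \<Longrightarrow> allowed (w' x y) (f x y)"
    "\<And>x. x \<in> insert a (V - A) \<Longrightarrow> (\<Sum>y\<in>insert a (V - A). f x y) = r' x"
    using sat unfolding satisfiable_def by metis
  have "\<exists>g. (\<forall>y\<in>A. allowed (w x y) (g y)) \<and> (\<Sum>y\<in>A. g y) = f x a" if "x \<in> V - A" for x
    using allowed_sum_split[OF finA(1)] f(2)[of x a] w'2[OF that] that by auto
  then obtain g where g: "\<And>x y. x \<in> V - A \<Longrightarrow> y \<in> A \<Longrightarrow> allowed (w x y) (g x y)"
    "\<And>x. x \<in> V - A \<Longrightarrow> (\<Sum>y\<in>A. g x y) = f x a"
    by metis
  define rA where "rA x = r x + (\<Sum>y\<in>V - A. g y x)" for x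
  have faa: "f a a = 0" using f(1)[of a a] Z3_eq_uminus by auto
  have "sum rA A = sum r A + (\<Sum>y\<in>V - A. \<Sum>x\<in>A. g y x)"
    unfolding rA_def sum.distrib by (subst sum.swap) simp
  also have "(\<Sum>y\<in>V - A. \<Sum>x\<in>A. g y x) = (\<Sum>y\<in>V - A. - f a y)"
    using g(2) f(1)[of _ a] by (intro sum.cong) auto
  also have "\<dots> = - (\<Sum>y\<in>insert a (V - A). f a y)"
    using finA faa A by (simp add: sum_negf)
  finally have s0: "sum rA A = 0" using f(3)[of a] r'2 by simp
  have "\<not> satisfiable A w rA"
  proof
    assume "satisfiable A w rA"
    then obtain h where h: "\<And>x y. x \<in> A \<Longrightarrow> y \<in> A \<Longrightarrow> h x y = - h y x"
      "\<And>x y. x \<in> A \<Longrightarrow> y \<in> A \<Longrightarrow> allowed (w x y) (h x y)"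
      "\<And>x. x \<in> A \<Longrightarrow> (\<Sum>y\<in>A. h x y) = rA x"
      unfolding satisfiable_def by metis
    define F where "F x y = (if x \<in> A then if y \<in> A then h x y else - g y x else
       if y \<in> A then g x y else f x y)" for x y
    have "F x y = - F y x \<and> allowed (w x y) (F x y)" if "x \<in> V" "y \<in> V" for x y
      using that h(1,2)[of x y] g(1)[of x y] g(1)[of y x] f(1,2)[of x y] w'1[of x y] wsym[of x y]
      unfolding F_def by auto
    moreover have "(\<Sum>y\<in>V. F x y) = r x" if "x \<in> V" for x
    proof (cases "x \<in> A")
      case True
      have "(\<Sum>y\<in>V. F x y) = (\<Sum>y\<in>A. h x y) + (\<Sum>y\<in>V-A. - g y x)"
        unfolding sum_diff_split[OF fin A(1)] using True by (intro arg_cong2[where f="(+)"] sum.cong) (auto simp: F_def)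
      then show ?thesis using h(3)[OF True] by (simp add: rA_def sum_negf)
    next
      case False
      have "(\<Sum>y\<in>V. F x y) = (\<Sum>y\<in>A. g x y) + (\<Sum>y\<in>V-A. f x y)"
        unfolding sum_diff_split[OF fin A(1)] using False by (intro arg_cong2[where f="(+)"] sum.cong) (auto simp: F_def)
      also have "\<dots> = (\<Sum>y\<in>insert a (V - A). f x y)" using g(2)[of x] that False finA A by simp
      also have "\<dots> = r x" using f(3)[of x] r'1[of x] that False by simp
      finally show ?thesis .
    qed
    ultimately have "satisfiable V w r" unfolding satisfiable_def by blast
    then show False using unsat by simp
  qed
  moreover have "full_degree (\<Sum>y\<in>A. w x y) (rA x) \<le> full_degree (\<Sum>y\<in>V. w x y) (r x)" if "x \<in> A" for x
  proof -
    have "allowed (\<Sum>y\<in>V-A. w x y) (\<Sum>y\<in>V-A. g y x)"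
      using g(1)[OF _ that] wsym[of x] finA(2) by (intro allowed_sum) auto
    from full_degree_allowed[OF this] show ?thesis
      unfolding rA_def sum_diff_split[OF fin A(1)] .
  qed
  ultimately show ?thesis using s0 unfolding locally_unsat_def by blast
qed

text \<open>Take an unsatisfiable contraction with fewest vertices. Collapsing a proper set
  \<open>A\<close> in it composes to a smaller contraction of the original, which is satisfiable by
  minimality; so \<open>A\<close> is locally unsatisfiable.\<close>

lemma critical_contraction_exists:
  fixes w :: "'v \<Rightarrow> 'v \<Rightarrow> nat"
  assumes fin: "finite U" and w: "wgraph w" and r: "sum r U = 0" and unsat: "\<not> satisfiable U w r"
  shows "\<exists>p. p ` U \<subseteq> U \<and> critical (p ` U) (contract_weight p U w) (contract_demand p U r)"
proof -
  define Q where "Q p \<longleftrightarrow> p ` U \<subseteq> U \<and> \<not> satisfiable (p ` U) (contract_weight p U w) (contract_demand p U r)" for p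
  have "Q id"
  proof -
    have fib: "{x \<in> U. id x = a} = {a}" if "a \<in> U" for a using that by auto
    have "satisfiable (id ` U) (contract_weight id U w) (contract_demand id U r) = satisfiable U w r"
      unfolding image_id id_apply
      by (rule satisfiable_cong) (use w in \<open>auto simp: contract_weight_def contract_demand_def fib[unfolded id_apply] wgraph_def\<close>)
    then show ?thesis using unsat by (simp add: Q_def)
  qed
  then obtain p where p: "Q p" and min: "\<And>q. Q q \<Longrightarrow> card (p ` U) \<le> card (q ` U)"
    using ex_has_least_nat[of Q id "\<lambda>p. card (p ` U)"] by blast
  define V where "V = p ` U"
  define w' where "w' = contract_weight p U w"
  define r' where "r' = contract_demand p U r"
  have V: "V \<subseteq> U" "finite V" using p fin by (auto simp: Q_def V_def)
  have w': "wgraph w'" unfolding w'_def using w by (rule wgraph_contract_weight)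
  have "locally_unsat w' (\<lambda>x. full_degree (\<Sum>y\<in>V. w' x y) (r' x)) A" if A: "A \<subset> V" "2 \<le> card A" for A
  proof -
    obtain a where a: "a \<in> A" using A by fastforce
    define q where "q x = (if x \<in> A then a else x)" for x
    have qV: "q ` V = insert a (V - A)" using A a by (auto simp: q_def)
    have finA: "finite A" using A V finite_subset by auto
    have "card (q ` V) = Suc (card V - card A)"
      unfolding qV using a V A finA by (simp add: card_Diff_subset psubset_imp_subset)
    moreover have "card A \<le> card V" using A V by (simp add: card_mono psubset_imp_subset)
    ultimately have "card (q ` V) < card V" using A by linarith
    then have "\<not> Q (q \<circ> p)" using min[of "q \<circ> p"] by (auto simp: V_def image_comp)
    moreover have "(q \<circ> p) ` U \<subseteq> U" using qV V A a unfolding V_def image_comp[symmetric] by blast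
    ultimately have sat: "satisfiable (insert a (V - A)) (contract_weight q V w') (contract_demand q V r')"
      unfolding Q_def w'_def r'_def V_def contract_weight_comp[OF fin] contract_demand_comp[OF fin]
      using qV by (simp add: V_def image_comp)
    have fib1: "{y \<in> V. q y = x} = {x}" if "x \<in> V - A" for x using that a by (auto simp: q_def)
    have fib2: "{y \<in> V. q y = a} = A" using a A by (auto simp: q_def)
    show ?thesis
    proof (rule locally_unsat_of_collapse[OF V(2) w' _ _ a sat])
      show "\<not> satisfiable V w' r'" using p by (simp add: Q_def V_def w'_def r'_def)
    qed (use A a w' in \<open>auto simp: contract_weight_def contract_demand_def fib1 fib2 wgraph_def\<close>)
  qed
  moreover have "sum r' V = 0" using sum_contract_demand[OF fin] r by (simp add: r'_def V_def)
  ultimately have "critical V w' r'" using V w' p unfolding critical_def Q_def V_def w'_def r'_def by blast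
  then show ?thesis using V unfolding V_def w'_def r'_def by blast
qed

section \<open>Degree bounds for contractions and vertex subsets\<close>

text \<open>The vertex count makes proper subsets and vertex removal smaller, the weight makes edge
  deletion smaller.\<close>

definition total_size :: "'v set \<Rightarrow> ('v \<Rightarrow> 'v \<Rightarrow> nat) \<Rightarrow> nat" where
  "total_size V w = card V + (\<Sum>x\<in>V. \<Sum>y\<in>V. w x y)"

text \<open>The two clauses are (a) and (b) of the overview. For a vertex subset, everything outside
  plays the role of the tip and \<open>M\<close> is the size of its boundary.\<close>

definition degree_bound :: "'v set \<Rightarrow> ('v \<Rightarrow> nat) \<Rightarrow> nat \<Rightarrow> bool" where
  "degree_bound V D M \<longleftrightarrow> (\<forall>x\<in>V. D x + 2 \<le> M) \<and>
     (M = 7 \<longrightarrow> (\<forall>x\<in>V. \<forall>y\<in>V. 5 \<le> D x \<longrightarrow> 5 \<le> D y \<longrightarrow> x = y))"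

definition outw :: "('v \<Rightarrow> 'v \<Rightarrow> nat) \<Rightarrow> 'v set \<Rightarrow> 'v set \<Rightarrow> nat" where
  "outw w U B = (\<Sum>x\<in>B. \<Sum>y\<in>U - B. w x y)"

text \<open>Extra tip edges at \<open>x\<close> raise both sides of (a) equally, so (a) at
  \<open>x\<close> depends only on the tip edges elsewhere. For (b), a rise of the total from 6 to 7
  supplies one extra tip edge, but at total 6 all full degrees are 4 and two vertices would each
  need one.\<close>

lemma degree_bound_mono_demand:
  assumes fin: "finite V"
    and db: "degree_bound V (\<lambda>x. d x + c x) (sum c V)"
    and cm: "\<And>x. x \<in> V \<Longrightarrow> c x \<le> m x"
    and ge4: "\<And>x. x \<in> V \<Longrightarrow> 4 \<le> d x + c x"
  shows "degree_bound V (\<lambda>x. d x + m x) (sum m V)"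
proof -
  have a: "d x + m x + 2 \<le> sum m V" if x: "x \<in> V" for x
  proof -
    have "d x + c x + 2 \<le> sum c V" using db x by (auto simp: degree_bound_def)
    also have "\<dots> = c x + sum c (V - {x})" using fin x by (simp add: sum.remove)
    also have "sum c (V - {x}) \<le> sum m (V - {x})" using cm by (intro sum_mono) auto
    finally have "d x + 2 \<le> sum m (V - {x})" by simp
    then show ?thesis using fin x by (simp add: sum.remove)
  qed
  have b: "x = y" if "sum m V = 7" and xy: "x \<in> V" "y \<in> V" "5 \<le> d x + m x" "5 \<le> d y + m y" for x y
  proof (rule ccontr)
    assume ne: "x \<noteq> y"
    have c6: "d u + c u + 2 \<le> sum c V" if "u \<in> V" for u using db that by (auto simp: degree_bound_def)
    have cle: "sum c V \<le> sum m V" using cm by (intro sum_mono) auto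
    have ge6: "6 \<le> sum c V" using c6[OF xy(1)] ge4[OF xy(1)] by simp
    have one: False if "u \<in> V" "d u + c u < d u + m u" "sum c V = 7" for u
    proof -
      have "sum c V < sum m V" using that cm fin by (intro sum_strict_mono_ex1) auto
      then show False using that \<open>sum m V = 7\<close> by simp
    qed
    show False
    proof (cases "sum c V = 7")
      case True
      then have "\<not> (5 \<le> d x + c x \<and> 5 \<le> d y + c y)" using db xy ne by (auto simp: degree_bound_def)
      then show False using one[OF xy(1) _ True] one[OF xy(2) _ True] xy by linarith
    next
      case False
      then have 6: "sum c V = 6" using cle ge6 \<open>sum m V = 7\<close> by simp
      then have "c x + 1 \<le> m x" "c y + 1 \<le> m y" using c6[OF xy(1)] c6[OF xy(2)] xy by linarith+
      moreover have "sum c V = c x + (c y + sum c (V - {x} - {y}))" "sum m V = m x + (m y + sum m (V - {x} - {y}))"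
        using xy fin ne by (simp_all add: sum.remove)
      moreover have "sum c (V - {x} - {y}) \<le> sum m (V - {x} - {y})" using cm by (intro sum_mono) auto
      ultimately show False using 6 \<open>sum m V = 7\<close> by linarith
    qed
  qed
  show ?thesis unfolding degree_bound_def using a b by blast
qed

text \<open>The numbers \<open>m\<close> of tip edges are arbitrary as long as every part of a contraction is tame;
  \<open>Q x\<close> is the part of \<open>x\<close> in a contraction that is critical.\<close>
lemma contracted_degree_bound:
  fixes w :: "'v \<Rightarrow> 'v \<Rightarrow> nat"
  assumes IH: "\<And>(V::'v set) w r. critical V w r \<Longrightarrow> total_size V w < N \<Longrightarrow>
      degree_bound V (\<lambda>x. full_degree (\<Sum>y\<in>V. w x y) (r x)) (\<Sum>x\<in>V. tip_demand (\<Sum>y\<in>V. w x y) (r x))"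
    and fin: "finite U" and w: "wgraph w" and r: "sum r U = 0" and unsat: "\<not> satisfiable U w r"
    and size: "total_size U w < N"
    and tame: "\<And>B. B \<noteq> {} \<Longrightarrow> B \<subset> U \<Longrightarrow> full_degree (outw w U B) (sum r B) \<le> outw w U B + sum m B"
  shows "\<exists>Q. (\<forall>x\<in>U. x \<in> Q x \<and> Q x \<subset> U \<and> outw w U (Q x) + sum m (Q x) + 2 \<le> sum m U) \<and>
    (sum m U = 7 \<longrightarrow> (\<forall>x\<in>U. \<forall>y\<in>U. 5 \<le> outw w U (Q x) + sum m (Q x) \<longrightarrow>
        5 \<le> outw w U (Q y) + sum m (Q y) \<longrightarrow> Q x = Q y))"
proof -
  obtain p where pU: "p ` U \<subseteq> U" and crit: "critical (p ` U) (contract_weight p U w) (contract_demand p U r)"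
    using critical_contraction_exists[OF fin w r unsat] by blast
  define V where "V = p ` U"
  define w' where "w' = contract_weight p U w"
  define r' where "r' = contract_demand p U r"
  define fib where "fib a = {x \<in> U. p x = a}" for a
  define m' where "m' a = sum m (fib a)" for a
  have finV: "finite V" using fin by (simp add: V_def)
  have grp: "(\<Sum>a\<in>V. \<Sum>x\<in>fib a. h x) = sum h U" for h :: "'v \<Rightarrow> nat"
    unfolding V_def fib_def using fin by (intro sum.group) auto
  have deg: "(\<Sum>b\<in>V. w' a b) = outw w U (fib a)" for a
  proof -
    have "(\<Sum>b\<in>V. w' a b) = (\<Sum>b\<in>V. if a = b then 0 else \<Sum>x\<in>fib a. \<Sum>y\<in>fib b. w x y)"
      by (simp only: w'_def contract_weight_def fib_def)
    also have "\<dots> = (\<Sum>b\<in>V. \<Sum>x\<in>fib a. \<Sum>y\<in>fib b. if p y = a then 0 else w x y)"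
      by (intro sum.cong refl) (auto simp: fib_def intro!: sum.cong)
    also have "\<dots> = (\<Sum>x\<in>fib a. \<Sum>b\<in>V. \<Sum>y\<in>fib b. if p y = a then 0 else w x y)"
      by (rule sum.swap)
    also have "\<dots> = (\<Sum>x\<in>fib a. \<Sum>y\<in>U. if p y = a then 0 else w x y)"
      by (simp add: grp)
    also have "\<dots> = outw w U (fib a)"
      unfolding outw_def using fin
      by (intro sum.cong refl sum.mono_neutral_cong_right) (auto simp: fib_def)
    finally show ?thesis .
  qed
  have size': "total_size V w' \<le> total_size U w"
  proof -
    have "(\<Sum>a\<in>V. \<Sum>b\<in>V. w' a b) \<le> (\<Sum>a\<in>V. \<Sum>x\<in>fib a. \<Sum>y\<in>U. w x y)"
      unfolding deg outw_def using fin by (intro sum_mono sum_mono2) auto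
    also have "\<dots> = (\<Sum>x\<in>U. \<Sum>y\<in>U. w x y)" by (rule grp)
    finally show ?thesis unfolding total_size_def V_def using card_image_le[OF fin, of p] by linarith
  qed
  define c where "c a = tip_demand (\<Sum>y\<in>V. w' a y) (r' a)" for a
  have "degree_bound V (\<lambda>x. full_degree (\<Sum>y\<in>V. w' x y) (r' x)) (\<Sum>x\<in>V. tip_demand (\<Sum>y\<in>V. w' x y) (r' x))"
    using IH[of V w' r'] crit size size' by (simp add: V_def w'_def r'_def)
  then have db0: "degree_bound V (\<lambda>a. (\<Sum>y\<in>V. w' a y) + c a) (sum c V)"
    by (simp add: c_def full_degree_def)
  have fibne: "fib a \<noteq> {}" if "a \<in> V" for a using that by (auto simp: V_def fib_def)
  \<comment> \<open>If one part were all of \<open>U\<close>, the contraction would be a single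
    vertex of full degree 4 with total demand 4, against (a).\<close>
  have psub: "fib a \<subset> U" if a: "a \<in> V" for a
  proof (rule ccontr)
    assume "\<not> fib a \<subset> U"
    then have "fib a = U" by (auto simp: fib_def)
    then have "V = {a}" using a by (auto simp: V_def fib_def)
    moreover have "w' a a = 0" by (simp add: w'_def contract_weight_def)
    ultimately show False using db0 by (simp add: degree_bound_def c_def tip_demand_def)
  qed
  have "degree_bound V (\<lambda>a. (\<Sum>y\<in>V. w' a y) + m' a) (sum m' V)"
  proof (rule degree_bound_mono_demand[OF finV db0])
    fix a assume a: "a \<in> V"
    show "c a \<le> m' a" using tame[OF fibne[OF a] psub[OF a]]
      by (simp add: c_def deg m'_def full_degree_def r'_def contract_demand_def fib_def)
    show "4 \<le> (\<Sum>y\<in>V. w' a y) + c a" using full_degree_ge(1) by (simp add: c_def full_degree_def)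
  qed
  then have db: "degree_bound V (\<lambda>a. outw w U (fib a) + sum m (fib a)) (sum m U)"
    by (simp add: deg m'_def grp)
  have "\<forall>x\<in>U. x \<in> fib (p x) \<and> fib (p x) \<subset> U \<and> outw w U (fib (p x)) + sum m (fib (p x)) + 2 \<le> sum m U"
    using db psub by (auto simp: degree_bound_def V_def fib_def)
  moreover have "fib (p x) = fib (p y)" if "sum m U = 7" "x \<in> U" "y \<in> U" "5 \<le> outw w U (fib (p x)) + sum m (fib (p x))"
        "5 \<le> outw w U (fib (p y)) + sum m (fib (p y))" for x y
  proof -
    have "p x = p y" using db that unfolding degree_bound_def V_def by blast
    then show ?thesis by simp
  qed
  ultimately show ?thesis by (intro exI[of _ "\<lambda>x. fib (p x)"]) blast
qed

text \<open>Each subset has its own bad demand, so the induction is on \<open>card A\<close> and the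
  demand is chosen afresh for \<open>A\<close>. By the bound for proper subsets, every part with at
  least two vertices has boundary at least 6 and is tame.\<close>

lemma set_degree_bound:
  fixes w :: "'v \<Rightarrow> 'v \<Rightarrow> nat"
  assumes IH: "\<And>(V::'v set) w r. critical V w r \<Longrightarrow> total_size V w < N \<Longrightarrow>
      degree_bound V (\<lambda>x. full_degree (\<Sum>y\<in>V. w x y) (r x)) (\<Sum>x\<in>V. tip_demand (\<Sum>y\<in>V. w x y) (r x))"
    and w: "wgraph w"
  shows "finite A \<Longrightarrow> 2 \<le> card A \<Longrightarrow> total_size A w < N \<Longrightarrow>
    (\<And>B. B \<subseteq> A \<Longrightarrow> 2 \<le> card B \<Longrightarrow> locally_unsat w D B) \<Longrightarrow>
    degree_bound A D (\<Sum>x\<in>A. D x - (\<Sum>y\<in>A. w x y))"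
proof (induction "card A" arbitrary: A rule: less_induct)
  case less
  note fin = less.prems(1)
  have "locally_unsat w D A" using less.prems by blast
  then obtain r where r: "sum r A = 0" "\<not> satisfiable A w r"
    and need: "\<And>x. x \<in> A \<Longrightarrow> full_degree (\<Sum>y\<in>A. w x y) (r x) \<le> D x"
    unfolding locally_unsat_def by blast
  \<comment> \<open>All edges leaving \<open>A\<close> are treated as tip edges.\<close>
  define m where "m x = D x - (\<Sum>y\<in>A. w x y)" for x
  have dD: "(\<Sum>y\<in>A. w x y) \<le> D x" if "x \<in> A" for x
    using need[OF that] full_degree_ge(2) order_trans by blast
  have bd: "outw w A B + sum m B = (\<Sum>x\<in>B. D x - (\<Sum>y\<in>B. w x y))" if B: "B \<subseteq> A" for B
    unfolding outw_def m_def sum.distrib[symmetric]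
  proof (intro sum.cong refl)
    fix x assume "x \<in> B"
    then have "(\<Sum>y\<in>A. w x y) \<le> D x" using dD B by blast
    then show "(\<Sum>y\<in>A - B. w x y) + (D x - (\<Sum>y\<in>A. w x y)) = D x - (\<Sum>y\<in>B. w x y)"
      using sum_diff_split[OF fin B, of "w x"] by linarith
  qed
  have sub: "degree_bound B D (\<Sum>x\<in>B. D x - (\<Sum>y\<in>B. w x y))" if B: "B \<subset> A" "2 \<le> card B" for B
  proof (rule less.hyps)
    show "card B < card A" using B fin by (rule_tac psubset_card_mono)
    show "finite B" using B fin finite_subset by auto
    have "(\<Sum>x\<in>B. \<Sum>y\<in>B. w x y) \<le> (\<Sum>x\<in>B. \<Sum>y\<in>A. w x y)"
      using B fin by (intro sum_mono sum_mono2) auto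
    also have "\<dots> \<le> (\<Sum>x\<in>A. \<Sum>y\<in>A. w x y)"
      using B fin by (intro sum_mono2) auto
    finally show "total_size B w < N" using less.prems \<open>card B < card A\<close> by (simp add: total_size_def)
  qed (use B less.prems in auto)
  have D4: "4 \<le> D x" if "x \<in> A" for x using need[OF that] full_degree_ge(1) order_trans by blast
  have big: "6 \<le> outw w A B + sum m B" "\<forall>x\<in>B. D x + 2 \<le> outw w A B + sum m B"
    if B: "B \<subset> A" "2 \<le> card B" for B
  proof -
    show *: "\<forall>x\<in>B. D x + 2 \<le> outw w A B + sum m B"
      using sub[OF B] bd[of B] B by (auto simp: degree_bound_def)
    obtain x where "x \<in> B" using B by fastforce
    then show "6 \<le> outw w A B + sum m B" using * D4 B by fastforce
  qed
  have single: "outw w A {x} + sum m {x} = D x" if "x \<in> A" for x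
    using bd[of "{x}"] that w by (simp add: wgraph_def)
  have tame: "full_degree (outw w A B) (sum r B) \<le> outw w A B + sum m B" if B: "B \<noteq> {}" "B \<subset> A" for B
  proof (cases "2 \<le> card B")
    case True
    then show ?thesis using big(1)[OF B(2) True] full_degree_le[of "outw w A B" "sum r B"] by linarith
  next
    case False
    have "finite B" using B fin finite_subset by auto
    then have "card B = 1" using B False by (metis One_nat_def Suc_leI card_gt_0_iff le_antisym not_less_eq_eq numeral_2_eq_2)
    then obtain x where x: "B = {x}" using card_1_singletonE by blast
    have "outw w A {x} = (\<Sum>y\<in>A. w x y)"
      using sum_diff_split[OF fin, of "{x}" "w x"] B x w by (auto simp: outw_def wgraph_def)
    then show ?thesis using single[of x] need[of x] B x by auto
  qed
  obtain Q where Q: "\<And>x. x \<in> A \<Longrightarrow> x \<in> Q x \<and> Q x \<subset> A \<and> outw w A (Q x) + sum m (Q x) + 2 \<le> sum m A"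
    "\<And>x y. sum m A = 7 \<Longrightarrow> x \<in> A \<Longrightarrow> y \<in> A \<Longrightarrow> 5 \<le> outw w A (Q x) + sum m (Q x) \<Longrightarrow>
        5 \<le> outw w A (Q y) + sum m (Q y) \<Longrightarrow> Q x = Q y"
    using contracted_degree_bound[OF IH fin w r less.prems(3) tame] by metis
  have Qs: "Q x = {x} \<or> 2 \<le> card (Q x)" if "x \<in> A" for x
  proof (rule ccontr)
    assume neg: "\<not> (Q x = {x} \<or> 2 \<le> card (Q x))"
    have "finite (Q x)" using Q(1)[OF that] fin finite_subset by blast
    moreover have "Q x \<noteq> {}" using Q(1)[OF that] by auto
    ultimately have "card (Q x) = 1" using neg by (metis One_nat_def Suc_leI card_gt_0_iff le_antisym not_less_eq_eq numeral_2_eq_2)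
    then show False using neg Q(1)[OF that] by (metis card_1_singletonE singletonD)
  qed
  have a: "D x + 2 \<le> sum m A" if x: "x \<in> A" for x
    using Qs[OF x] Q(1)[OF x] single[OF x] big(2)[of "Q x"] by fastforce
  have b: "x = y" if M: "sum m A = 7" and xy: "x \<in> A" "y \<in> A" "5 \<le> D x" "5 \<le> D y" for x y
  proof -
    \<comment> \<open>At total 7 a part has boundary at most 5, whereas larger parts have at least
      6.\<close>
    have s: "Q u = {u}" if u: "u \<in> A" for u
      using Qs[OF u] Q(1)[OF u] big(1)[of "Q u"] M by fastforce
    show ?thesis using Q(2)[OF M xy(1,2)] s[OF xy(1)] s[OF xy(2)] single xy by auto
  qed
  show ?case using a b unfolding degree_bound_def m_def by blast
qed

section \<open>The inductive step: vertices of full degree 4\<close>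

definition edge_weight :: "'v \<Rightarrow> 'v \<Rightarrow> 'v \<Rightarrow> 'v \<Rightarrow> nat" where
  "edge_weight u v a b = (if a = u \<and> b = v \<or> a = v \<and> b = u then 1 else 0)"

lemma wgraph_add_edge: "wgraph w \<Longrightarrow> u \<noteq> v \<Longrightarrow> wgraph (\<lambda>a b. w a b + edge_weight u v a b)"
  by (auto simp: wgraph_def edge_weight_def)

lemma allowed_Suc_0: "allowed (Suc 0) a \<longleftrightarrow> a \<noteq> 0"
  by (simp add: allowed_def)

text \<open>Serves in both directions: splitting off reads off the value \<open>s\<close> of a new
  edge, edge deletion prescribes it in advance.\<close>

lemma satisfiable_add_edge:
  assumes fin: "finite V" and uv: "u \<in> V" "v \<in> V" "u \<noteq> v" and w: "wgraph w"
  shows "satisfiable V (\<lambda>a b. w a b + edge_weight u v a b) r \<longleftrightarrow>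
    (\<exists>s. s \<noteq> 0 \<and> satisfiable V w (\<lambda>x. r x - (if x = u then s else 0) + (if x = v then s else 0)))"
    (is "?L \<longleftrightarrow> ?R")
proof -
  define E where "E s a b = (if a = u \<and> b = v then s else 0) - (if a = v \<and> b = u then s else 0)" for s :: Z3 and a b
  have E1: "E s a b = - E s b a" for s a b using uv by (auto simp: E_def)
  have E2: "(\<Sum>b\<in>V. E s a b) = (if a = u then s else 0) - (if a = v then s else 0)" for s a
    using fin uv by (auto simp: E_def sum_subtractf)
  have wuv: "w v u = w u v" using w by (simp add: wgraph_def)
  show ?thesis
  proof
    assume ?L
    then obtain f where f: "\<And>x y. x \<in> V \<Longrightarrow> y \<in> V \<Longrightarrow> f x y = - f y x"
      "\<And>x y. x \<in> V \<Longrightarrow> y \<in> V \<Longrightarrow> allowed (w x y + edge_weight u v x y) (f x y)"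
      "\<And>x. x \<in> V \<Longrightarrow> (\<Sum>y\<in>V. f x y) = r x"
      unfolding satisfiable_def by metis
    have "allowed (1 + w u v) (f u v)" using f(2)[of u v] uv by (simp add: edge_weight_def)
    then obtain s where s: "s \<noteq> 0" "allowed (w u v) (f u v - s)"
      using allowed_split[of 1 "w u v" "f u v"] by (auto simp: allowed_Suc_0)
    have "f v u + s = - (f u v - s)" using f(1)[of u v] uv by simp
    then have s': "allowed (w u v) (f v u + s)" using s by (simp only: allowed_uminus)
    have "(\<forall>x\<in>V. \<forall>y\<in>V. f x y - E s x y = - (f y x - E s y x) \<and> allowed (w x y) (f x y - E s x y))"
    proof (intro ballI conjI)
      fix x y assume xy: "x \<in> V" "y \<in> V"
      show "f x y - E s x y = - (f y x - E s y x)" using f(1)[OF xy] E1[of s x y] by simp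
      show "allowed (w x y) (f x y - E s x y)"
        using f(2)[OF xy] s s' uv wuv by (auto simp: E_def edge_weight_def split: if_splits)
    qed
    moreover have "(\<Sum>y\<in>V. f x y - E s x y) = r x - (if x = u then s else 0) + (if x = v then s else 0)"
      if "x \<in> V" for x
      using f(3)[OF that] E2[of s x] by (simp add: sum_subtractf)
    ultimately show ?R using s(1) unfolding satisfiable_def
      by (intro exI[of _ s] conjI exI[of _ "\<lambda>x y. f x y - E s x y"]; blast)
  next
    assume ?R
    then obtain s f where s: "s \<noteq> 0" and f: "\<And>x y. x \<in> V \<Longrightarrow> y \<in> V \<Longrightarrow> f x y = - f y x"
      "\<And>x y. x \<in> V \<Longrightarrow> y \<in> V \<Longrightarrow> allowed (w x y) (f x y)"
      "\<And>x. x \<in> V \<Longrightarrow> (\<Sum>y\<in>V. f x y) = r x - (if x = u then s else 0) + (if x = v then s else 0)"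
      unfolding satisfiable_def by metis
    have "(\<forall>x\<in>V. \<forall>y\<in>V. f x y + E s x y = - (f y x + E s y x) \<and>
      allowed (w x y + edge_weight u v x y) (f x y + E s x y))"
    proof (intro ballI conjI)
      fix x y assume xy: "x \<in> V" "y \<in> V"
      show "f x y + E s x y = - (f y x + E s y x)" using f(1)[OF xy] E1[of s x y] by simp
      have "allowed (edge_weight u v x y) (E s x y)"
        using s uv by (auto simp: E_def edge_weight_def allowed_def)
      then show "allowed (w x y + edge_weight u v x y) (f x y + E s x y)"
        using f(2)[OF xy] by (intro allowed_add)
    qed
    moreover have "(\<Sum>y\<in>V. f x y + E s x y) = r x" if "x \<in> V" for x
      using f(3)[OF that] E2[of s x] by (simp add: sum.distrib)
    ultimately show ?L unfolding satisfiable_def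
      by (intro conjI exI[of _ "\<lambda>x y. f x y + E s x y"]; blast)
  qed
qed

lemma satisfiable_add_vertex:
  assumes fin: "finite V" and x: "x \<in> V" and w: "wgraph w"
    and g: "\<And>u. u \<in> V - {x} \<Longrightarrow> allowed (w x u) (g u)" "sum g (V - {x}) = r x"
    and sat: "satisfiable (V - {x}) w (\<lambda>u. r u + g u)"
  shows "satisfiable V w r"
proof -
  obtain f where f: "\<And>a b. a \<in> V - {x} \<Longrightarrow> b \<in> V - {x} \<Longrightarrow> f a b = - f b a"
      "\<And>a b. a \<in> V - {x} \<Longrightarrow> b \<in> V - {x} \<Longrightarrow> allowed (w a b) (f a b)"
      "\<And>a. a \<in> V - {x} \<Longrightarrow> (\<Sum>b\<in>V - {x}. f a b) = r a + g a"
    using sat unfolding satisfiable_def by metis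
  define F where "F a b = (if a = x then if b = x then 0 else g b else if b = x then - g a else f a b)" for a b
  have "F a b = - F b a \<and> allowed (w a b) (F a b)" if "a \<in> V" "b \<in> V" for a b
    using that f(1,2)[of a b] g(1)[of a] g(1)[of b] w
    by (auto simp: F_def wgraph_def) (auto simp: allowed_def)
  moreover have "(\<Sum>b\<in>V. F a b) = r a" if "a \<in> V" for a
  proof -
    have "(\<Sum>b\<in>V. F a b) = F a x + (\<Sum>b\<in>V - {x}. F a b)" using fin x by (simp add: sum.remove)
    also have "(\<Sum>b\<in>V - {x}. F a b) = (\<Sum>b\<in>V - {x}. if a = x then g b else f a b)"
      by (intro sum.cong) (auto simp: F_def)
    also have "F a x + \<dots> = r a" using f(3)[of a] g(2) that by (auto simp: F_def)
    finally show ?thesis .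
  qed
  ultimately show ?thesis unfolding satisfiable_def by blast
qed

lemma outw_add_edge:
  assumes "finite U" "B \<subseteq> U" "u \<in> U" "v \<in> U"
  shows "outw (\<lambda>a b. w a b + edge_weight u v a b) U B = outw w U B + (if (u \<in> B) \<noteq> (v \<in> B) then 1 else 0)"
proof -
  have finB: "finite B" "finite (U - B)" using assms finite_subset by auto
  have "(\<Sum>a\<in>B. \<Sum>b\<in>U - B. edge_weight u v a b) =
     (\<Sum>a\<in>B. (if a = u \<and> v \<in> U - B then 1 else 0) + (if a = v \<and> u \<in> U - B then 1 else 0))"
  proof (intro sum.cong refl)
    fix a assume a: "a \<in> B"
    have "(\<Sum>b\<in>U - B. edge_weight u v a b) =
       (\<Sum>b\<in>U - B. (if b = v then if a = u then 1 else 0 else 0) + (if b = u then if a = v then 1 else 0 else 0))"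
      using a by (intro sum.cong) (auto simp: edge_weight_def)
    then show "(\<Sum>b\<in>U - B. edge_weight u v a b) = (if a = u \<and> v \<in> U - B then 1 else 0) + (if a = v \<and> u \<in> U - B then 1 else 0)"
      using finB by (auto simp: sum.distrib)
  qed
  also have "\<dots> = (if (u \<in> B) \<noteq> (v \<in> B) then 1 else 0)"
    using finB assms by (cases "v \<in> B"; cases "u \<in> B") (auto simp: sum.distrib)
  finally show ?thesis by (simp add: outw_def sum.distrib)
qed

lemma sum_edge_weight:
  assumes "finite U" "u \<in> U" "v \<in> U" "u \<noteq> v"
  shows "(\<Sum>a\<in>U. \<Sum>b\<in>U. edge_weight u v a b) = 2"
proof -
  have "(\<Sum>b\<in>U. edge_weight u v a b) = (if a = u then 1 else 0) + (if a = v then 1 else 0)" for a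
  proof -
    have "(\<Sum>b\<in>U. edge_weight u v a b) =
       (\<Sum>b\<in>U. (if b = v then if a = u then 1 else 0 else 0) + (if b = u then if a = v then 1 else 0 else 0))"
      using assms by (intro sum.cong) (auto simp: edge_weight_def)
    then show ?thesis using assms by (simp add: sum.distrib)
  qed
  then show ?thesis using assms by (simp add: sum.distrib)
qed

lemma even_sum_weight:
  assumes w: "wgraph w" shows "finite A \<Longrightarrow> even (\<Sum>x\<in>A. \<Sum>y\<in>A. w x y)"
proof (induction A rule: finite_induct)
  case (insert a A)
  have 0: "w a a = 0" "(\<Sum>x\<in>A. w x a) = (\<Sum>x\<in>A. w a x)"
    using w by (auto simp: wgraph_def intro!: sum.cong)
  then show ?case using insert by (simp add: sum.distrib)
qed simp

lemma card_ge2_or_singleton: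
  assumes "finite B" "x \<in> B" shows "2 \<le> card B \<or> B = {x}"
proof (cases "B - {x} = {}")
  case False
  then have "0 < card (B - {x})" using assms(1) by (metis card_0_eq finite_Diff gr0I)
  then show ?thesis using card.remove[OF assms] by simp
qed (use assms in auto)

section \<open>Cuts of a critical demand, given the bounds for smaller ones\<close>

locale critical_step =
  fixes V :: "'v set" and w :: "'v \<Rightarrow> 'v \<Rightarrow> nat" and r :: "'v \<Rightarrow> Z3"
  assumes crit: "critical V w r"
    and IH: "\<And>V' w' r'. critical (V'::'v set) w' r' \<Longrightarrow> total_size V' w' < total_size V w \<Longrightarrow>
      degree_bound V' (\<lambda>x. full_degree (\<Sum>y\<in>V'. w' x y) (r' x)) (\<Sum>x\<in>V'. tip_demand (\<Sum>y\<in>V'. w' x y) (r' x))"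
    and card3: "3 \<le> card V"
begin

definition d where "d x = (\<Sum>y\<in>V. w x y)"
definition c where "c x = tip_demand (d x) (r x)"
definition D where "D x = full_degree (d x) (r x)"
text \<open>The degree of \<open>A\<close> in the graph where each vertex is given its minimal
  number of tip edges.\<close>

definition bd where "bd A = outw w V A + sum c A"

lemma fin: "finite V" and wg: "wgraph w" and r0: "sum r V = 0" and unsat: "\<not> satisfiable V w r"
  using crit by (auto simp: critical_def)

lemma wsym: "w x y = w y x" and wdiag [simp]: "w x x = 0"
  using wg by (auto simp: wgraph_def)

lemma D_eq: "D x = d x + c x" by (simp add: D_def c_def full_degree_def)

lemma D_ge4: "4 \<le> D x" by (simp add: D_def full_degree_ge)

lemma finite_sub: "A \<subseteq> V \<Longrightarrow> finite A" using fin finite_subset by auto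

lemma sub_locally_unsat: "A \<subset> V \<Longrightarrow> 2 \<le> card A \<Longrightarrow> locally_unsat w D A"
  using crit unfolding critical_def D_def[abs_def] d_def[abs_def] by blast

lemma bd_alt: "A \<subseteq> V \<Longrightarrow> bd A + (\<Sum>x\<in>A. \<Sum>y\<in>A. w x y) = sum D A"
  unfolding bd_def outw_def sum.distrib[symmetric] D_eq d_def
  by (intro sum.cong refl) (simp add: sum_diff_split[OF fin, of A])

lemma bd_bound:
  assumes A: "A \<subset> V" "2 \<le> card A"
  shows "degree_bound A D (bd A)"
proof -
  have "(\<Sum>x\<in>A. D x - (\<Sum>y\<in>A. w x y)) = bd A"
    unfolding bd_def outw_def sum.distrib[symmetric] D_eq d_def
    using A by (intro sum.cong refl) (simp add: sum_diff_split[OF fin, of A] psubset_imp_subset)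
  moreover have "degree_bound A D (\<Sum>x\<in>A. D x - (\<Sum>y\<in>A. w x y))"
  proof (rule set_degree_bound[OF IH wg])
    show "finite A" using A finite_sub by auto
    have "(\<Sum>x\<in>A. \<Sum>y\<in>A. w x y) \<le> (\<Sum>x\<in>A. \<Sum>y\<in>V. w x y)"
      using A fin by (intro sum_mono sum_mono2) auto
    also have "\<dots> \<le> (\<Sum>x\<in>V. \<Sum>y\<in>V. w x y)"
      using A fin by (intro sum_mono2) auto
    finally show "total_size A w < total_size V w"
      using psubset_card_mono[OF fin A(1)] by (simp add: total_size_def)
    show "locally_unsat w D B" if "B \<subseteq> A" "2 \<le> card B" for B
      using sub_locally_unsat that A by blast
  qed (use A in auto)
  ultimately show ?thesis by simp
qed

lemma bd_ge: "A \<subset> V \<Longrightarrow> 2 \<le> card A \<Longrightarrow> x \<in> A \<Longrightarrow> D x + 2 \<le> bd A"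
  using bd_bound by (auto simp: degree_bound_def)

lemma bd_ge6: assumes "A \<subset> V" "2 \<le> card A" shows "6 \<le> bd A"
proof -
  obtain x where "x \<in> A" using assms by fastforce
  then show ?thesis using bd_ge[OF assms, of x] D_ge4[of x] by simp
qed

lemma outw_single: "x \<in> V \<Longrightarrow> outw w V {x} = d x"
  using sum_diff_split[OF fin, of "{x}" "w x"] by (simp add: outw_def d_def)

lemma bd_single: "x \<in> V \<Longrightarrow> bd {x} = D x"
  by (simp add: bd_def outw_single D_eq)

text \<open>Two parallel edges carry any value, so the demand on their ends could always be met; but
  a pair is a proper subset here, hence locally unsatisfiable.\<close>

lemma simple: "x \<in> V \<Longrightarrow> y \<in> V \<Longrightarrow> w x y \<le> 1"
proof (rule ccontr)
  assume xy: "x \<in> V" "y \<in> V" "\<not> w x y \<le> 1"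
  then have ne: "x \<noteq> y" by auto
  then have c2: "card {x, y} = 2" by simp
  then have "{x, y} \<noteq> V" using card3 by auto
  then have "locally_unsat w D {x, y}" using xy c2 by (intro sub_locally_unsat) auto
  then obtain q where q: "q x + q y = 0" "\<not> satisfiable {x, y} w q"
    using ne by (auto simp: locally_unsat_def)
  define f where "f a b = (if a = x \<and> b = y then q x else if a = y \<and> b = x then q y else 0)" for a b
  have "q y = - q x" using q(1) by (simp add: eq_neg_iff_add_eq_0 add.commute)
  then have "satisfiable {x, y} w q"
    unfolding satisfiable_def using xy ne wsym[of x y]
    by (intro exI[of _ f]) (auto simp: f_def allowed_def)
  then show False using q by simp
qed

text \<open>A set keeps being tame after it loses two boundary edges of a split-off pair. Only the cut sizes 6 and 7
  are delicate: there all vertices but at most one have full degree 4, which determines \<open>sum r C\<close>.\<close>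
lemma slack:
  assumes C: "C \<subset> V" "2 \<le> card C" and k: "outw w V C = k + 2"
  shows "full_degree k (sum r C) \<le> k + sum c C"
proof -
  have finC: "finite C" using C finite_sub by auto
  have bk: "bd C = k + 2 + sum c C" by (simp add: bd_def k)
  consider "bd C = 6" | "bd C = 7" | "8 \<le> bd C" using bd_ge6[OF C] by linarith
  then show ?thesis
  proof cases
    case 1
    have "D x = 4" if "x \<in> C" for x using bd_ge[OF C that] D_ge4[of x] 1 by simp
    then have *: "d x \<le> 4" "allowed (4 - d x) (r x)" "c x = 4 - d x" if "x \<in> C" for x
      using that full_degree_eq_4[of "d x" "r x"] D_eq[of x] by (auto simp: D_def)
    have "allowed (sum c C) (sum r C)" using * finC by (intro allowed_sum) auto
    moreover have "k \<le> 4" "sum c C = 4 - k" using 1 bk by auto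
    ultimately have "full_degree k (sum r C) = 4" by (simp add: full_degree_eq_4)
    then show ?thesis using 1 bk by simp
  next
    case 2
    show ?thesis
    proof (cases "k = 5 \<and> sum r C = 0")
      case False
      then show ?thesis using 2 bk full_degree_le_5[of k "sum r C"] by auto
    next
      case True
      then have "sum c C = 0" using bk 2 by simp
      then have c0: "c x = 0" if "x \<in> C" for x using that finC by simp
      \<comment> \<open>Inner edges count twice, so the odd cut size forces a vertex of odd full
        degree; by (a) it is 5, and by (b) the only one above 4.\<close>
      have "odd (sum D C)" using bd_alt[of C] even_sum_weight[OF wg finC] 2 C
        by (metis even_add odd_numeral psubset_imp_subset)
      then obtain x0 where x0: "x0 \<in> C" "odd (D x0)" by (meson dvd_sum)
      have "D x0 = 5" using bd_ge[OF C x0(1)] 2 D_ge4[of x0] x0(2) by (cases "D x0 = 4") auto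
      have D4: "D x = 4" if "x \<in> C - {x0}" for x
      proof -
        have "\<not> 5 \<le> D x" using bd_bound[OF C] 2 that x0 \<open>D x0 = 5\<close> by (auto simp: degree_bound_def)
        then show ?thesis using D_ge4[of x] by simp
      qed
      have "r x = 0" if "x \<in> C - {x0}" for x
        using D4[OF that] full_degree_eq_4[of "d x" "r x"] D_eq[of x] c0[of x] that by (auto simp: D_def allowed_def)
      then have "sum r C = r x0" using sum.remove[OF finC x0(1), of r] by simp
      \<comment> \<open>With no tip edge \<open>x0\<close> has five edges, and demand 0 would then
        require a tip edge.\<close>
      moreover have "r x0 \<noteq> 0" using \<open>D x0 = 5\<close> c0[OF x0(1)] D_eq[of x0] by (auto simp: c_def tip_demand_def split: if_splits)
      ultimately show ?thesis using True by simp
    qed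
  next
    case 3
    then show ?thesis using full_degree_le[of k "sum r C"] bk by linarith
  qed
qed

text \<open>When \<open>x\<close> is split off, the cut around a set \<open>B\<close> is compared with the original cut around
  \<open>B\<close> or around \<open>B\<close> together with \<open>x\<close>, whichever loses at most two edges.\<close>
lemma remove_vertex_bound:
  assumes x: "x \<in> V" "D x = 4" and U: "U = V - {x}" and wg': "wgraph w'"
    and unsat': "\<not> satisfiable U w' r'" and r': "sum r' U = 0"
    and size: "(\<Sum>a\<in>U. \<Sum>b\<in>U. w' a b) \<le> (\<Sum>a\<in>V. \<Sum>b\<in>V. w a b)"
    and m': "sum m' U = sum c V"
    and cond: "\<And>B. B \<noteq> {} \<Longrightarrow> B \<subset> U \<Longrightarrow> \<exists>C. (C = B \<or> C = insert x B) \<and> sum m' B = sum c C \<and>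
      sum r' B = sum r C \<and> (outw w' U B = outw w V C \<or> outw w' U B + 2 = outw w V C \<and> 2 \<le> card C)"
  shows "degree_bound V D (sum c V)"
proof -
  have finU: "finite U" using fin U by simp
  have cardU: "card U < card V" "2 \<le> card U" using x U fin card3 by (auto simp: card_Diff_singleton)
  \<comment> \<open>By \<open>cond\<close>, only sets of at least two vertices can lose edges;
    singletons keep their degree.\<close>
  have cases: "\<exists>C. B \<subseteq> C \<and> C \<subset> V \<and> sum r' B = sum r C \<and> sum m' B = sum c C \<and>
      ((\<exists>y. C = {y} \<and> outw w' U B = d y) \<or> 2 \<le> card C \<and> (outw w' U B = outw w V C \<or> outw w' U B + 2 = outw w V C))"
    if B: "B \<noteq> {}" "B \<subset> U" for B
  proof -
    obtain C where C: "C = B \<or> C = insert x B" "sum m' B = sum c C" "sum r' B = sum r C"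
      "outw w' U B = outw w V C \<or> outw w' U B + 2 = outw w V C \<and> 2 \<le> card C"
      using cond[OF B] by blast
    have CV: "B \<subseteq> C" "C \<subset> V" using C(1) B U x(1) by auto
    obtain y where y: "y \<in> C" using B C by blast
    have "2 \<le> card C \<or> C = {y}" using card_ge2_or_singleton[OF _ y] CV finite_sub by auto
    then have "(\<exists>y. C = {y} \<and> outw w' U B = d y) \<or>
        2 \<le> card C \<and> (outw w' U B = outw w V C \<or> outw w' U B + 2 = outw w V C)"
    proof
      assume "C = {y}"
      then have "outw w' U B = d y" using C(4) outw_single[of y] CV y by auto
      then show ?thesis using \<open>C = {y}\<close> by blast
    qed (use C(4) in blast)
    then show ?thesis using C CV by blast
  qed
  have tame: "full_degree (outw w' U B) (sum r' B) \<le> outw w' U B + sum m' B"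
    if B: "B \<noteq> {}" "B \<subset> U" for B
  proof -
    obtain C where C: "C \<subset> V" "sum r' B = sum r C" "sum m' B = sum c C" and
      or: "(\<exists>y. C = {y} \<and> outw w' U B = d y) \<or> 2 \<le> card C \<and> (outw w' U B = outw w V C \<or> outw w' U B + 2 = outw w V C)"
      using cases[OF B] by blast
    from or consider y where "C = {y}" "outw w' U B = d y" | "2 \<le> card C" "outw w' U B = outw w V C" | "2 \<le> card C" "outw w' U B + 2 = outw w V C" by blast
    then show ?thesis
    proof cases
      case 1 then show ?thesis using C D_eq by (simp add: D_def)
    next
      case 2 then show ?thesis using C bd_ge6[of C] full_degree_le[of "outw w V C" "sum r C"] by (simp add: bd_def)
    next
      case 3 then show ?thesis using slack[of C] C by simp
    qed
  qed
  have size': "total_size U w' < total_size V w" using size cardU by (simp add: total_size_def)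
  obtain Q where Q: "\<And>y. y \<in> U \<Longrightarrow> y \<in> Q y \<and> Q y \<subset> U \<and> outw w' U (Q y) + sum m' (Q y) + 2 \<le> sum m' U"
    "\<And>u v. sum m' U = 7 \<Longrightarrow> u \<in> U \<Longrightarrow> v \<in> U \<Longrightarrow> 5 \<le> outw w' U (Q u) + sum m' (Q u) \<Longrightarrow>
        5 \<le> outw w' U (Q v) + sum m' (Q v) \<Longrightarrow> Q u = Q v"
    using contracted_degree_bound[OF IH finU wg' r' unsat' size' tame] by metis
  \<comment> \<open>The two lost edges are paid for by the 2 in (a). If two vertices of full degree
    at least 5 lie in the part, (b) excludes cut size 7, so the cut is at least 8 and at least 6
    remain.\<close>
  have low: "D y \<le> outw w' U (Q u) + sum m' (Q u) \<and>
    (5 \<le> D y \<longrightarrow> y' \<in> Q u \<longrightarrow> 5 \<le> D y' \<longrightarrow> y \<noteq> y' \<longrightarrow> 6 \<le> outw w' U (Q u) + sum m' (Q u))" if u: "u \<in> U" "y \<in> Q u" for u y y'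
  proof -
    have "Q u \<noteq> {}" "Q u \<subset> U" using u Q(1) by auto
    then obtain C where C: "Q u \<subseteq> C" "C \<subset> V" "sum m' (Q u) = sum c C" and
      or: "(\<exists>y. C = {y} \<and> outw w' U (Q u) = d y) \<or> 2 \<le> card C \<and> (outw w' U (Q u) = outw w V C \<or> outw w' U (Q u) + 2 = outw w V C)"
      using cases[of "Q u"] by blast
    have yC: "y \<in> C" using u C by auto
    from or consider "C = {y}" "outw w' U (Q u) = d y" | "2 \<le> card C" "outw w V C \<le> outw w' U (Q u) + 2"
      using yC by fastforce
    then show ?thesis
    proof cases
      case 1
      then have "Q u \<subseteq> {y}" using C by simp
      then show ?thesis using 1 C(3) D_eq[of y] by auto
    next
      case 2
      have le: "bd C \<le> outw w' U (Q u) + sum m' (Q u) + 2" using 2 C(3) by (simp add: bd_def)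
      have "6 \<le> outw w' U (Q u) + sum m' (Q u)" if *: "5 \<le> D y" "y' \<in> Q u" "5 \<le> D y'" "y \<noteq> y'"
      proof -
        have "y' \<in> C" using * C by auto
        then have "bd C \<noteq> 7" using bd_bound[OF C(2) 2(1)] * yC unfolding degree_bound_def by blast
        then show ?thesis using bd_ge[OF C(2) 2(1) yC] * le by linarith
      qed
      moreover have "D y \<le> outw w' U (Q u) + sum m' (Q u)" using bd_ge[OF C(2) 2(1) yC] le by linarith
      ultimately show ?thesis by blast
    qed
  qed
  have a: "D y + 2 \<le> sum c V" if "y \<in> U" for y
    using Q(1)[OF that] low[OF that, of y y] m' by auto
  obtain y0 where "y0 \<in> U" using cardU by fastforce
  then have ax: "D x + 2 \<le> sum c V" using a[of y0] D_ge4[of y0] x by simp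
  have b: "y = y'" if "sum c V = 7" "y \<in> U" "y' \<in> U" "5 \<le> D y" "5 \<le> D y'" for y y'
  proof (rule ccontr)
    assume ne: "y \<noteq> y'"
    have "5 \<le> outw w' U (Q y) + sum m' (Q y)" "5 \<le> outw w' U (Q y') + sum m' (Q y')"
      using low[of y y y] low[of y' y' y'] Q(1)[of y] Q(1)[of y'] that by auto
    then have "Q y = Q y'" using Q(2) that m' by simp
    then have "6 \<le> outw w' U (Q y) + sum m' (Q y)" using low[of y y y'] Q(1)[of y] Q(1)[of y'] that ne by auto
    then show False using Q(1)[of y] that m' by simp
  qed
  show ?thesis unfolding degree_bound_def
  proof (intro conjI ballI impI)
    fix y assume "y \<in> V"
    then show "D y + 2 \<le> sum c V" using a ax U by (cases "y = x") auto
  next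
    fix y y' assume *: "sum c V = 7" "y \<in> V" "y' \<in> V" "5 \<le> D y" "5 \<le> D y'"
    then have "y \<noteq> x" "y' \<noteq> x" using x(2) by auto
    then show "y = y'" using b * U by auto
  qed
qed

end

section \<open>Splitting off a vertex of full degree 4\<close>

context critical_step begin

definition nbrs where "nbrs x = {u \<in> V. w x u = 1}"

lemma nbrs_subset: "nbrs x \<subseteq> V - {x}"
  by (auto simp: nbrs_def)

lemma w_nbrs: "x \<in> V \<Longrightarrow> u \<in> V \<Longrightarrow> w x u = (if u \<in> nbrs x then 1 else 0)"
  using simple[of x u] by (auto simp: nbrs_def)

lemma sum_w_nbrs:
  assumes "x \<in> V" "B \<subseteq> V"
  shows "(\<Sum>u\<in>B. w x u) = (\<Sum>u\<in>nbrs x. if u \<in> B then 1 else 0)"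
proof -
  have finN: "finite (nbrs x)" using fin by (simp add: nbrs_def)
  have "(\<Sum>u\<in>B. w x u) = (\<Sum>u\<in>B. if u \<in> nbrs x then 1 else 0)"
    using assms by (intro sum.cong refl w_nbrs) auto
  also have "\<dots> = card (B \<inter> nbrs x)"
    using sum.inter_restrict[OF finite_sub[OF assms(2)], of "\<lambda>_. 1::nat" "nbrs x"] by simp
  also have "\<dots> = (\<Sum>u\<in>nbrs x. if u \<in> B then 1 else 0)"
    using sum.inter_restrict[OF finN, of "\<lambda>_. 1::nat" B] by (simp add: Int_commute)
  finally show ?thesis .
qed

lemma d_card: "x \<in> V \<Longrightarrow> d x = card (nbrs x)"
  using sum_w_nbrs[of x V] by (simp add: d_def nbrs_def)

lemma outw_remove:
  assumes x: "x \<in> V" and B: "B \<subseteq> V - {x}"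
  shows "outw w V B = outw w (V - {x}) B + (\<Sum>u\<in>B. w x u)"
    and "outw w V (insert x B) = outw w (V - {x}) B + (\<Sum>u\<in>V - {x} - B. w x u)"
proof -
  have fB: "finite B" using B finite_sub by auto
  have e: "V - B = insert x (V - {x} - B)" using x B by auto
  show "outw w V B = outw w (V - {x}) B + (\<Sum>u\<in>B. w x u)"
    unfolding outw_def e using fin by (simp add: sum.distrib wsym[of _ x])
  have e2: "V - insert x B = V - {x} - B" by auto
  show "outw w V (insert x B) = outw w (V - {x}) B + (\<Sum>u\<in>V - {x} - B. w x u)"
    unfolding outw_def e2 using fB B by (subst sum.insert) auto
qed

lemma sum_weight_remove:
  assumes x: "x \<in> V"
  shows "(\<Sum>a\<in>V. \<Sum>b\<in>V. w a b) = (\<Sum>a\<in>V - {x}. \<Sum>b\<in>V - {x}. w a b) + 2 * d x"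
proof -
  have "(\<Sum>b\<in>V. w a b) = (\<Sum>b\<in>V - {x}. w a b) + w x a" for a
    using fin x wsym[of a x] by (simp add: sum.remove)
  then have "(\<Sum>a\<in>V. \<Sum>b\<in>V. w a b) = (\<Sum>a\<in>V. \<Sum>b\<in>V - {x}. w a b) + d x"
    by (simp add: sum.distrib d_def)
  also have "(\<Sum>a\<in>V. \<Sum>b\<in>V - {x}. w a b) = (\<Sum>b\<in>V - {x}. w x b) + (\<Sum>a\<in>V - {x}. \<Sum>b\<in>V - {x}. w a b)"
    using fin x by (rule sum.remove)
  also have "(\<Sum>b\<in>V - {x}. w x b) = d x" using fin x by (simp add: d_def sum.remove)
  finally show ?thesis by simp
qed

lemma outw_compl: "x \<in> V \<Longrightarrow> outw w V (V - {x}) = d x"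
proof -
  assume x: "x \<in> V"
  then have "V - (V - {x}) = {x}" by auto
  then have "outw w V (V - {x}) = (\<Sum>a\<in>V - {x}. w x a)"
    unfolding outw_def using wsym[of _ x] by simp
  then show ?thesis using fin x by (simp add: d_def sum.remove)
qed

lemma bd_compl: "x \<in> V \<Longrightarrow> bd (V - {x}) + c x = d x + sum c V"
  using fin by (simp add: bd_def outw_compl sum.remove)

lemma compl_proper: "x \<in> V \<Longrightarrow> V - {x} \<subset> V \<and> 2 \<le> card (V - {x})"
  using card3 fin by (auto simp: card_Diff_singleton)

text \<open>Here \<open>x\<close> has at least as many tip edges as other edges, so the cut around
  the remaining vertices is at most the total tip demand, and its bounds suffice.\<close>

lemma degree_bound_if_4_small:
  assumes x: "x \<in> V" "D x = 4" "d x \<le> 2"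
  shows "degree_bound V D (sum c V)"
proof -
  have A: "V - {x} \<subset> V" "2 \<le> card (V - {x})" using compl_proper x by auto
  have "c x = 4 - d x" using x D_eq[of x] by simp
  then have le: "bd (V - {x}) \<le> sum c V" using bd_compl[OF x(1)] x by linarith
  have ge: "6 \<le> bd (V - {x})" using bd_ge6[OF A] .
  have a: "D y + 2 \<le> sum c V" if "y \<in> V" for y
  proof (cases "y = x")
    case False
    then have "D y + 2 \<le> bd (V - {x})" using bd_ge[OF A] that by simp
    then show ?thesis using le by linarith
  qed (use x ge le in simp)
  have b: "y = y'" if *: "sum c V = 7" "y \<in> V" "y' \<in> V" "5 \<le> D y" "5 \<le> D y'" for y y'
  proof -
    have n: "y \<in> V - {x}" "y' \<in> V - {x}" using * x by auto
    then have "bd (V - {x}) = 7" using bd_ge[OF A n(1)] le * by linarith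
    then show ?thesis using bd_bound[OF A] n * by (simp add: degree_bound_def)
  qed
  show ?thesis using a b unfolding degree_bound_def by blast
qed

text \<open>Two edges at \<open>x\<close> become an edge \<open>u1 u2\<close>; the third is joined
  to the tip edge of \<open>x\<close> and becomes a tip edge of \<open>u3\<close> carrying
  \<open>r x\<close>. In the cut comparison \<open>x\<close> goes to the side of \<open>u3\<close>,
  so that its tip edge is counted there.\<close>

lemma degree_bound_if_4_three:
  assumes x: "x \<in> V" "D x = 4" "d x = 3"
  shows "degree_bound V D (sum c V)"
proof -
  have "card (nbrs x) = 3" using d_card x by simp
  then obtain u1 u2 u3 where N: "nbrs x = {u1, u2, u3}" and ne: "u1 \<noteq> u2" "u1 \<noteq> u3" "u2 \<noteq> u3"
    by (auto simp: card_3_iff)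
  have uU: "u1 \<in> V - {x}" "u2 \<in> V - {x}" "u3 \<in> V - {x}" using N nbrs_subset[of x] by auto
  define U where "U = V - {x}"
  have finU: "finite U" using fin by (simp add: U_def)
  have c1: "c x = 1" using x D_eq[of x] by simp
  have rx: "r x \<noteq> 0" using x full_degree_eq_4[of "d x" "r x"] by (auto simp: D_def allowed_def)
  define w' where "w' a b = w a b + edge_weight u1 u2 a b" for a b
  define r' where "r' a = r a + (if a = u3 then r x else 0)" for a
  define m' where "m' a = c a + (if a = u3 then 1 else 0)" for a
  show ?thesis
  proof (rule remove_vertex_bound[OF x(1,2) U_def, of w' r' m'])
    show "wgraph w'" unfolding w'_def using wg ne by (intro wgraph_add_edge)
    show "\<not> satisfiable U w' r'"
    proof
      assume "satisfiable U w' r'"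
      then obtain s where s: "s \<noteq> 0"
        "satisfiable U w (\<lambda>a. r' a - (if a = u1 then s else 0) + (if a = u2 then s else 0))"
        using satisfiable_add_edge[OF finU _ _ ne(1) wg, of r'] uU by (auto simp: w'_def[abs_def] U_def)
      \<comment> \<open>The value \<open>s\<close> of the new edge runs from \<open>u1\<close>
        through \<open>x\<close> to \<open>u2\<close>; the demand of \<open>x\<close> is sent to
        \<open>u3\<close>.\<close>
      define g where "g a = (if a = u3 then r x else 0) - (if a = u1 then s else 0) + (if a = u2 then s else 0)" for a
      have "satisfiable V w r"
      proof (rule satisfiable_add_vertex[OF fin x(1) wg, of g])
        show "allowed (w x u) (g u)" if "u \<in> V - {x}" for u
          using that w_nbrs[OF x(1), of u] ne s rx by (auto simp: N g_def allowed_def)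
        show "sum g (V - {x}) = r x"
          using fin uU by (simp add: g_def[abs_def] sum.distrib sum_subtractf)
        have "(\<lambda>a. r' a - (if a = u1 then s else 0) + (if a = u2 then s else 0)) = (\<lambda>u. r u + g u)"
          by (auto simp: r'_def g_def)
        then show "satisfiable (V - {x}) w (\<lambda>u. r u + g u)" using s by (simp add: U_def)
      qed
      then show False using unsat by simp
    qed
    show "sum r' U = 0" using r0 sum.remove[OF fin x(1), of r] fin uU by (simp add: r'_def[abs_def] sum.distrib U_def add.commute)
    show "sum m' U = sum c V" using c1 sum.remove[OF fin x(1), of c] fin uU by (simp add: m'_def[abs_def] sum.distrib U_def)
    have "(\<Sum>a\<in>U. \<Sum>b\<in>U. w' a b) = (\<Sum>a\<in>U. \<Sum>b\<in>U. w a b) + 2"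
      using sum_edge_weight[OF finU _ _ ne(1)] uU by (simp add: w'_def sum.distrib U_def)
    then show "(\<Sum>a\<in>U. \<Sum>b\<in>U. w' a b) \<le> (\<Sum>a\<in>V. \<Sum>b\<in>V. w a b)"
      using sum_weight_remove[OF x(1)] x by (simp add: U_def)
    fix B assume B: "B \<noteq> {}" "B \<subset> U"
    then have finB: "finite B" and xB: "x \<notin> B" and BV: "B \<subseteq> V" using finU finite_subset by (auto simp: U_def)
    have BU: "B \<subseteq> V - {x}" using B by (auto simp: U_def)
    have ins: "sum h (insert x B) = h x + sum h B" for h :: "'v \<Rightarrow> 'z::comm_monoid_add" using finB xB by simp
    have card2: "2 \<le> card (insert x B)" using finB xB B by (simp add: Suc_leI card_gt_0_iff)
    have o': "outw w' U B = outw w U B + (if (u1 \<in> B) \<noteq> (u2 \<in> B) then 1 else 0)"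
      unfolding w'_def using B uU by (intro outw_add_edge[OF finU]) (auto simp: U_def)
    have o1: "outw w V B = outw w U B + ((if u1 \<in> B then 1 else 0) + (if u2 \<in> B then 1 else 0) + (if u3 \<in> B then 1 else 0))"
      unfolding U_def using outw_remove(1)[OF x(1) BU] sum_w_nbrs[OF x(1) BV] ne by (simp add: N)
    have VB: "V - {x} - B \<subseteq> V" by auto
    have o2: "outw w V (insert x B) = outw w U B + ((if u1 \<in> B then 0 else 1) + (if u2 \<in> B then 0 else 1) + (if u3 \<in> B then 0 else 1))"
      unfolding U_def using outw_remove(2)[OF x(1) BU] sum_w_nbrs[OF x(1) VB] ne uU by (simp add: N)
    have m: "sum m' B = sum c B + (if u3 \<in> B then 1 else 0)" using finB by (simp add: m'_def[abs_def] sum.distrib)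
    have r: "sum r' B = sum r B + (if u3 \<in> B then r x else 0)" using finB by (simp add: r'_def[abs_def] sum.distrib)
    show "\<exists>C. (C = B \<or> C = insert x B) \<and> sum m' B = sum c C \<and> sum r' B = sum r C \<and>
       (outw w' U B = outw w V C \<or> outw w' U B + 2 = outw w V C \<and> 2 \<le> card C)"
    proof (cases "u3 \<in> B")
      case True
      then show ?thesis using card2 m r o' o2 ins[of c] ins[of r] c1
        by (intro exI[of _ "insert x B"]) auto
    next
      case False
      have "2 \<le> card B" if "u1 \<in> B" "u2 \<in> B"
        using card_ge2_or_singleton[OF finB that(1)] that ne by auto
      then show ?thesis using False m r o' o1 by (intro exI[of _ B]) auto
    qed
  qed
qed

text \<open>With no tip edge and demand 0 at \<open>x\<close>, its edges split into two pairs. A set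
  containing all four neighbours would lose four edges, so \<open>x\<close> is added to it for the
  comparison.\<close>

lemma degree_bound_if_4_four:
  assumes x: "x \<in> V" "D x = 4" "d x = 4"
  shows "degree_bound V D (sum c V)"
proof -
  have c4: "card (nbrs x) = 4" using d_card x by simp
  then obtain u1 N' where N1: "nbrs x = insert u1 N'" "u1 \<notin> N'" "card N' = 3"
    by (metis card_eq_SucD eval_nat_numeral(2,3) numeral_eq_Suc pred_numeral_simps(2) semiring_norm(26,27))
  then obtain u2 u3 u4 where N: "nbrs x = {u1, u2, u3, u4}"
    and ne: "u1 \<noteq> u2" "u1 \<noteq> u3" "u2 \<noteq> u3" "u1 \<noteq> u4" "u2 \<noteq> u4" "u3 \<noteq> u4"
    by (auto simp: card_3_iff)
  have uU: "u1 \<in> V - {x}" "u2 \<in> V - {x}" "u3 \<in> V - {x}" "u4 \<in> V - {x}" using N nbrs_subset[of x] by auto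
  define U where "U = V - {x}"
  have finU: "finite U" using fin by (simp add: U_def)
  have c0: "c x = 0" using x D_eq[of x] by simp
  have rx: "r x = 0" using x full_degree_eq_4[of "d x" "r x"] by (auto simp: D_def allowed_def)
  define w1 where "w1 a b = w a b + edge_weight u1 u2 a b" for a b
  define w' where "w' a b = w1 a b + edge_weight u3 u4 a b" for a b
  have wg1: "wgraph w1" unfolding w1_def using wg ne by (intro wgraph_add_edge)
  show ?thesis
  proof (rule remove_vertex_bound[OF x(1,2) U_def, of w' r c])
    show "wgraph w'" unfolding w'_def using wg1 ne by (intro wgraph_add_edge)
    show "\<not> satisfiable U w' r"
    proof
      assume "satisfiable U w' r"
      then obtain t where t: "t \<noteq> 0"
        "satisfiable U w1 (\<lambda>a. r a - (if a = u3 then t else 0) + (if a = u4 then t else 0))"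
        using satisfiable_add_edge[OF finU _ _ ne(6) wg1, of r] uU by (auto simp: w'_def[abs_def] U_def)
      then obtain s where s: "s \<noteq> 0"
        "satisfiable U w (\<lambda>a. r a - (if a = u3 then t else 0) + (if a = u4 then t else 0) - (if a = u1 then s else 0) + (if a = u2 then s else 0))"
        using satisfiable_add_edge[OF finU _ _ ne(1) wg] uU by (auto simp: w1_def[abs_def] U_def)
      define g where "g a = - (if a = u3 then t else 0) + (if a = u4 then t else 0) - (if a = u1 then s else 0) + (if a = u2 then s else 0)" for a
      have "satisfiable V w r"
      proof (rule satisfiable_add_vertex[OF fin x(1) wg, of g])
        show "allowed (w x u) (g u)" if "u \<in> V - {x}" for u
          using that w_nbrs[OF x(1), of u] ne s t by (auto simp: N g_def allowed_def)
        show "sum g (V - {x}) = r x"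
          using fin uU rx by (simp add: g_def[abs_def] sum.distrib sum_subtractf sum_negf)
        have "(\<lambda>a. r a - (if a = u3 then t else 0) + (if a = u4 then t else 0) - (if a = u1 then s else 0) + (if a = u2 then s else 0)) = (\<lambda>u. r u + g u)"
          by (auto simp: g_def)
        then show "satisfiable (V - {x}) w (\<lambda>u. r u + g u)" using s by (simp add: U_def)
      qed
      then show False using unsat by simp
    qed
    show "sum r U = 0" using r0 sum.remove[OF fin x(1), of r] rx by (simp add: U_def)
    show "sum c U = sum c V" using c0 sum.remove[OF fin x(1), of c] by (simp add: U_def)
    have "(\<Sum>a\<in>U. \<Sum>b\<in>U. w' a b) = (\<Sum>a\<in>U. \<Sum>b\<in>U. w a b) + 4"
      using sum_edge_weight[OF finU _ _ ne(1)] sum_edge_weight[OF finU _ _ ne(6)] uU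
      by (simp add: w'_def w1_def sum.distrib U_def)
    then show "(\<Sum>a\<in>U. \<Sum>b\<in>U. w' a b) \<le> (\<Sum>a\<in>V. \<Sum>b\<in>V. w a b)"
      using sum_weight_remove[OF x(1)] x by (simp add: U_def)
    fix B assume B: "B \<noteq> {}" "B \<subset> U"
    then have finB: "finite B" and xB: "x \<notin> B" and BV: "B \<subseteq> V" using finU finite_subset by (auto simp: U_def)
    have BU: "B \<subseteq> V - {x}" "B \<subseteq> U" using B by (auto simp: U_def)
    have ins: "sum h (insert x B) = h x + sum h B" for h :: "'v \<Rightarrow> 'z::comm_monoid_add" using finB xB by simp
    have card2: "2 \<le> card (insert x B)" using finB xB B by (simp add: Suc_leI card_gt_0_iff)
    have "outw w' U B = outw w1 U B + (if (u3 \<in> B) \<noteq> (u4 \<in> B) then 1 else 0)"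
      unfolding w'_def using BU uU by (intro outw_add_edge[OF finU]) (auto simp: U_def)
    also have "outw w1 U B = outw w U B + (if (u1 \<in> B) \<noteq> (u2 \<in> B) then 1 else 0)"
      unfolding w1_def using BU uU by (intro outw_add_edge[OF finU]) (auto simp: U_def)
    finally have o': "outw w' U B = outw w U B + (if (u1 \<in> B) \<noteq> (u2 \<in> B) then 1 else 0) + (if (u3 \<in> B) \<noteq> (u4 \<in> B) then 1 else 0)" .
    have o1: "outw w V B = outw w U B + ((if u1 \<in> B then 1 else 0) + (if u2 \<in> B then 1 else 0) + (if u3 \<in> B then 1 else 0) + (if u4 \<in> B then 1 else 0))"
      unfolding U_def using outw_remove(1)[OF x(1) BU(1)] sum_w_nbrs[OF x(1) BV] ne by (simp add: N)
    have VB: "V - {x} - B \<subseteq> V" by auto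
    have o2: "outw w V (insert x B) = outw w U B + ((if u1 \<in> B then 0 else 1) + (if u2 \<in> B then 0 else 1) + (if u3 \<in> B then 0 else 1) + (if u4 \<in> B then 0 else 1))"
      unfolding U_def using outw_remove(2)[OF x(1) BU(1)] sum_w_nbrs[OF x(1) VB] ne uU by (simp add: N)
    show "\<exists>C. (C = B \<or> C = insert x B) \<and> sum c B = sum c C \<and> sum r B = sum r C \<and>
       (outw w' U B = outw w V C \<or> outw w' U B + 2 = outw w V C \<and> 2 \<le> card C)"
    proof (cases "u1 \<in> B \<and> u2 \<in> B \<and> u3 \<in> B \<and> u4 \<in> B")
      case True
      then show ?thesis using o' o2 ins[of c] ins[of r] c0 rx
        by (intro exI[of _ "insert x B"]) auto
    next
      case False
      have "2 \<le> card B" if "u1 \<in> B \<and> u2 \<in> B \<or> u3 \<in> B \<and> u4 \<in> B"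
        using card_ge2_or_singleton[OF finB, of u1] card_ge2_or_singleton[OF finB, of u3] that ne by auto
      then show ?thesis using False o' o1 by (intro exI[of _ B]) auto
    qed
  qed
qed

lemma degree_bound_if_4: "x \<in> V \<Longrightarrow> D x = 4 \<Longrightarrow> degree_bound V D (sum c V)"
  using degree_bound_if_4_small[of x] degree_bound_if_4_three[of x] degree_bound_if_4_four[of x] D_eq[of x]
  by (cases "d x \<le> 2"; cases "d x = 3"; cases "d x = 4") auto

end

section \<open>The inductive step: all full degrees at least 5\<close>

lemma full_degree_ge5_imp: "5 \<le> full_degree d a \<Longrightarrow> 3 \<le> d"
  by (auto simp: full_degree_def tip_demand_def split: if_splits)

lemma tip_demand_dec_exists:
  assumes "5 \<le> full_degree d a"
  shows "tip_demand (d - 1) (a + 1) \<le> tip_demand d a \<or> tip_demand (d - 1) (a + - 1) \<le> tip_demand d a"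
proof -
  consider "d = 3" | "d = 4" | "d = 5" | "d = 6" | "7 \<le> d" using full_degree_ge5_imp[OF assms] by linarith
  then show ?thesis
    by cases (use assms Z3_cases[of a] in \<open>auto simp: full_degree_def tip_demand_def split: if_splits\<close>)
qed

text \<open>After the deletion the worse demand is 0 at degrees 3 and 5 but nonzero at degree 4,
  whence the alternating signs for 4, 5 and 6. In all other cases both signs are harmless.\<close>

lemma tip_demand_dec_unique:
  assumes "5 \<le> full_degree d a" and s: "s \<noteq> 0"
    and "\<not> tip_demand (d - 1) (a + - s) \<le> tip_demand d a"
  shows "d = 4 \<and> a = s \<or> d = 5 \<and> a = - s \<or> d = 6 \<and> a = s"
proof -
  consider "d = 3" | "d = 4" | "d = 5" | "d = 6" | "7 \<le> d" using full_degree_ge5_imp[OF assms(1)] by linarith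
  then show ?thesis
    by cases (use assms Z3_cases[of a] Z3_cases[of s] in \<open>auto simp: full_degree_def tip_demand_def split: if_splits\<close>)
qed

locale critical_step5 = critical_step +
  assumes D5: "x \<in> V \<Longrightarrow> 5 \<le> D x"
begin

lemma d_ge3: "x \<in> V \<Longrightarrow> 3 \<le> d x"
  using D5 full_degree_ge5_imp by (auto simp: D_def)

text \<open>The set contains two vertices of full degree at least 5, so (a) gives 7 and (b) excludes
  7.\<close>

lemma bd_ge8:
  assumes A: "A \<subset> V" "2 \<le> card A" shows "8 \<le> bd A"
proof -
  obtain x where x: "x \<in> A" using A by fastforce
  have "finite A" using A finite_sub by auto
  then have "A \<noteq> {x}" using A by auto
  then obtain y where y: "y \<in> A" "y \<noteq> x" using x by blast
  have "7 \<le> bd A" using bd_ge[OF A x] D5[of x] x A by auto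
  moreover have "bd A \<noteq> 7" using bd_bound[OF A] D5[of x] D5[of y] x y A unfolding degree_bound_def by blast
  ultimately show ?thesis by simp
qed

text \<open>An edge at \<open>x\<close> may be deleted with demand change \<open>s\<close> at \<open>x\<close> without increasing the tip demand.\<close>
definition good where "good s x \<longleftrightarrow> tip_demand (d x - 1) (r x + s) \<le> c x"

lemma good_exists: "x \<in> V \<Longrightarrow> good 1 x \<or> good (-1) x"
  using tip_demand_dec_exists[of "d x" "r x"] D5[of x] by (simp add: good_def c_def D_def)

lemma good_unique: "x \<in> V \<Longrightarrow> s \<noteq> 0 \<Longrightarrow> \<not> good (- s) x \<Longrightarrow>
   d x = 4 \<and> r x = s \<or> d x = 5 \<and> r x = - s \<or> d x = 6 \<and> r x = s"
  using tip_demand_dec_unique[of "d x" "r x" s] D5[of x] by (simp add: good_def c_def D_def)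

text \<open>The edge is deleted with value \<open>s\<close> from \<open>u\<close> to
  \<open>x\<close>. Cuts of size at least 8 drop to at least 7, so larger parts stay tame. The ends
  lose an edge, so the bounds come back only for the other vertices.\<close>

lemma delete_edge_bound:
  assumes ux: "u \<in> V" "x \<in> V" "w x u = 1" and s: "s \<noteq> 0" "good s x" "good (- s) u"
  shows "(\<forall>y\<in>V - {u, x}. D y + 2 \<le> sum c V) \<and> (sum c V = 7 \<longrightarrow> (\<forall>y\<in>V - {u, x}. \<forall>y'\<in>V - {u, x}. y = y'))"
proof -
  have ne: "u \<noteq> x" using ux by auto
  define w' where "w' a b = w a b - edge_weight u x a b" for a b
  define r' where "r' a = r a - (if a = u then s else 0) + (if a = x then s else 0)" for a
  have ww: "w = (\<lambda>a b. w' a b + edge_weight u x a b)"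
    using ux wsym[of u x] by (auto simp: w'_def edge_weight_def fun_eq_iff)
  have wg': "wgraph w'"
    unfolding wgraph_def w'_def using wsym by (auto simp: edge_weight_def)
  have unsat': "\<not> satisfiable V w' r'"
    using satisfiable_add_edge[OF fin ux(1,2) ne wg', of r] s unsat ww unfolding r'_def[abs_def] by auto
  have sum': "sum r' V = 0" using r0 fin ux by (simp add: r'_def[abs_def] sum.distrib sum_subtractf)
  have "(\<Sum>a\<in>V. \<Sum>b\<in>V. w a b) = (\<Sum>a\<in>V. \<Sum>b\<in>V. w' a b) + 2"
    by (subst ww) (simp add: sum.distrib sum_edge_weight[OF fin ux(1,2) ne])
  then have size': "total_size V w' < total_size V w" by (simp add: total_size_def)
  have out: "outw w V B = outw w' V B + (if (u \<in> B) \<noteq> (x \<in> B) then 1 else 0)" if "B \<subseteq> V" for B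
    by (subst ww) (rule outw_add_edge[OF fin that ux(1,2)])
  have big: "bd B \<le> outw w' V B + sum c B + 1" if "B \<subseteq> V" for B
    using out[OF that] by (simp add: bd_def)
  have single: "d y = outw w' V {y} + (if y = u \<or> y = x then 1 else 0)" if "y \<in> V" for y
    using out[of "{y}"] outw_single[OF that] that ne by auto
  have tame: "full_degree (outw w' V B) (sum r' B) \<le> outw w' V B + sum c B" if B: "B \<noteq> {}" "B \<subset> V" for B
  proof -
    obtain y where y: "y \<in> B" using B by auto
    have yV: "y \<in> V" using y B by auto
    have "finite B" using B finite_sub by auto
    from card_ge2_or_singleton[OF this y] show ?thesis
    proof
      assume "2 \<le> card B"
      then show ?thesis using bd_ge8[OF B(2)] big[of B] B full_degree_le[of "outw w' V B" "sum r' B"] by auto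
    next
      assume [simp]: "B = {y}"
      have "tip_demand (outw w' V {y}) (r' y) \<le> c y"
        using single[OF yV] s ne by (cases "y = u"; cases "y = x") (auto simp: good_def r'_def c_def)
      then show ?thesis by (simp add: full_degree_def)
    qed
  qed
  obtain Q where Q: "\<And>y. y \<in> V \<Longrightarrow> y \<in> Q y \<and> Q y \<subset> V \<and> outw w' V (Q y) + sum c (Q y) + 2 \<le> sum c V"
    "\<And>y y'. sum c V = 7 \<Longrightarrow> y \<in> V \<Longrightarrow> y' \<in> V \<Longrightarrow> 5 \<le> outw w' V (Q y) + sum c (Q y) \<Longrightarrow>
        5 \<le> outw w' V (Q y') + sum c (Q y') \<Longrightarrow> Q y = Q y'"
    using contracted_degree_bound[OF IH fin wg' sum' unsat' size' tame] by metis
  have Qs: "2 \<le> card (Q y) \<or> Q y = {y}" if "y \<in> V" for y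
    using Q(1)[OF that] card_ge2_or_singleton[of "Q y" y] finite_sub[of "Q y"] by auto
  have val: "D y = outw w' V {y} + sum c {y}" if "y \<in> V - {u, x}" for y
    using single[of y] that D_eq[of y] by auto
  have a: "D y + 2 \<le> sum c V" if y: "y \<in> V - {u, x}" for y
  proof -
    have yV: "y \<in> V" using y by simp
    from Qs[OF yV] show ?thesis
    proof
      assume *: "2 \<le> card (Q y)"
      have "D y + 2 \<le> bd (Q y)" using bd_ge[of "Q y" y] Q(1)[OF yV] * by auto
      then show ?thesis using big[of "Q y"] Q(1)[OF yV] by auto
    next
      assume "Q y = {y}"
      then show ?thesis using val[OF y] Q(1)[OF yV] by auto
    qed
  qed
  have b: "y = y'" if M: "sum c V = 7" and y: "y \<in> V - {u, x}" "y' \<in> V - {u, x}" for y y'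
  proof -
    have yV: "y \<in> V" "y' \<in> V" using y by auto
    have Q1: "Q z = {z}" if "z \<in> V" for z
      using Qs[OF that] Q(1)[OF that] bd_ge8[of "Q z"] big[of "Q z"] M by auto
    have "Q y = Q y'" using Q(2)[OF M yV] Q1[OF yV(1)] Q1[OF yV(2)] val[OF y(1)] val[OF y(2)] D5[OF yV(1)] D5[OF yV(2)] by auto
    then show ?thesis using Q1 yV by auto
  qed
  show ?thesis using a b by blast
qed

text \<open>All four edges leave \<open>x\<close> with flow \<open>s\<close>, which meets the demand since \<open>4 * s = s\<close>. The vertices of \<open>Y\<close>
  each receive one extra tip edge; with \<open>card Y = 1\<close> it is the one freed by \<open>x\<close>.\<close>
lemma remove_degree_4_vertex:
  assumes x: "x \<in> V" "d x = 4" "r x = s" "s \<noteq> 0" and Y: "Y \<subseteq> V - {x}"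
    and good: "\<And>u. u \<in> V - {x} - Y \<Longrightarrow> w x u = 1 \<Longrightarrow> good s u"
    and y: "y \<in> V - {x}"
  shows "\<exists>k. k + 3 \<le> sum c V + card Y \<and> (6 \<le> k \<and> D y \<le> k \<or> k + w x y = D y + (if y \<in> Y then 1 else 0))"
proof -
  define U where "U = V - {x}"
  define g where "g u = (if w x u = 1 then s else 0)" for u
  define r' where "r' u = r u + g u" for u
  define m where "m u = c u + (if u \<in> Y then 1 else 0)" for u
  have finU: "finite U" using fin by (simp add: U_def)
  have finY: "finite Y" using Y finite_sub by auto
  have three: "3 * s = 0" using Z3_three[of s] by simp
  have "sum g U = (\<Sum>u\<in>nbrs x. s)"
    unfolding g_def nbrs_def U_def using fin by (intro sum.mono_neutral_cong_right) auto
  also have "\<dots> = s" using d_card[OF x(1)] x(2) three by simp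
  finally have sg: "sum g U = r x" using x by simp
  have unsat': "\<not> satisfiable U w r'"
  proof
    assume "satisfiable U w r'"
    then have "satisfiable V w r"
      using sg x(4) simple[OF x(1)] unfolding U_def r'_def[abs_def]
      by (intro satisfiable_add_vertex[OF fin x(1) wg, of g]) (auto simp: g_def allowed_def le_Suc_eq)
    then show False using unsat by simp
  qed
  have sum': "sum r' U = 0" using r0 sum.remove[OF fin x(1), of r] sg
    by (simp add: r'_def[abs_def] sum.distrib U_def add.commute)
  have cx: "c x = 1" using x by (simp add: c_def tip_demand_def)
  have "sum m U = sum c U + card (U \<inter> Y)"
    using sum.inter_restrict[OF finU, of "\<lambda>_. 1::nat" Y] by (simp add: m_def[abs_def] sum.distrib)
  moreover have "U \<inter> Y = Y" using Y by (auto simp: U_def)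
  \<comment> \<open>The 1 is the tip edge of \<open>x\<close>, which disappears with
    \<open>x\<close>.\<close>
  ultimately have sm: "sum m U + 1 = sum c V + card Y"
    using sum.remove[OF fin x(1), of c] cx by (simp add: U_def)
  have size': "total_size U w < total_size V w"
    using sum_weight_remove[OF x(1)] x by (auto simp: total_size_def U_def intro!: add_less_le_mono psubset_card_mono[OF fin])
  have mc: "sum c B \<le> sum m B" for B by (intro sum_mono) (simp add: m_def)
  have tot: "(\<Sum>u\<in>B. w x u) + (\<Sum>u\<in>V - {x} - B. w x u) = 4" if "B \<subseteq> U" for B
  proof -
    have "(\<Sum>u\<in>V. w x u) = (\<Sum>u\<in>U. w x u)" using fin x by (simp add: U_def sum.remove)
    then show ?thesis using sum_diff_split[OF finU that, of "w x"] x by (simp add: d_def U_def)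
  qed
  \<comment> \<open>\<open>B\<close> loses \<open>k\<close> edges and \<open>insert x B\<close>
    loses \<open>5 - k\<close>, the tip edge of \<open>x\<close> included; one of the two losses is
    at most 2.\<close>
  have big: "6 \<le> outw w U B + sum m B \<and> (\<forall>y\<in>B. D y \<le> outw w U B + sum m B)" if B: "B \<subset> U" "2 \<le> card B" for B
  proof -
    define k where "k = (\<Sum>u\<in>B. w x u)"
    have BU: "B \<subseteq> V - {x}" "B \<subseteq> U" using B by (auto simp: U_def)
    have finB: "finite B" using BU finU finite_subset by auto
    have BV: "B \<subset> V" "insert x B \<subset> V" "2 \<le> card (insert x B)"
      using B x finB card_insert_le[of B x] by (auto simp: U_def)
    have "bd B = outw w U B + k + sum c B"
      using outw_remove(1)[OF x(1) BU(1)] by (simp add: bd_def k_def U_def)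
    moreover have "bd (insert x B) + k = outw w U B + 4 + sum c B + 1"
      using outw_remove(2)[OF x(1) BU(1)] tot[OF BU(2)] finB BU cx
      by (simp add: bd_def k_def U_def subset_Diff_insert)
    ultimately have *: "p \<le> outw w U B + sum m B" if "p + 2 \<le> bd B" "p + 2 \<le> bd (insert x B)" for p
      using that mc[of B] by linarith
    show ?thesis using *[of 6] bd_ge8[of B] bd_ge8[of "insert x B"] BV B
        *[of "D _"] bd_ge[of B] bd_ge[of "insert x B"] by auto
  qed
  have single: "outw w U {z} + w x z = d z" if "z \<in> U" for z
    using outw_remove(1)[OF x(1), of "{z}"] outw_single[of z] that by (simp add: U_def)
  have tame: "full_degree (outw w U B) (sum r' B) \<le> outw w U B + sum m B" if B: "B \<noteq> {}" "B \<subset> U" for B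
  proof -
    obtain z where z: "z \<in> B" using B by auto
    have zU: "z \<in> U" using z B by auto
    have "finite B" using B finU finite_subset by auto
    from card_ge2_or_singleton[OF this z] show ?thesis
    proof
      assume "2 \<le> card B"
      then show ?thesis using big[OF B(2)] full_degree_le[of "outw w U B" "sum r' B"] by auto
    next
      assume [simp]: "B = {z}"
      have "w x z = 0 \<or> w x z = 1" using simple[OF x(1), of z] zU by (auto simp: U_def le_Suc_eq)
      then show ?thesis
      proof
        assume 0: "w x z = 0"
        then show ?thesis using single[OF zU] by (simp add: r'_def g_def full_degree_def m_def c_def)
      next
        assume 1: "w x z = 1"
        then have dz: "d z = Suc (outw w U {z})" using single[OF zU] by simp
        show ?thesis
        proof (cases "z \<in> Y")
          case True
          have "full_degree (outw w U {z}) (r z + s) \<le> full_degree (d z) (r z)"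
            using full_degree_step[OF x(4), of "outw w U {z}" "r z"] dz by simp
          then show ?thesis using True 1 dz D_eq[of z] by (simp add: r'_def g_def m_def D_def)
        next
          case False
          then have "good s z" using good[of z] zU 1 by (simp add: U_def)
          then show ?thesis using False 1 dz by (simp add: good_def r'_def g_def m_def full_degree_def)
        qed
      qed
    qed
  qed
  obtain Q where Q: "\<And>y. y \<in> U \<Longrightarrow> y \<in> Q y \<and> Q y \<subset> U \<and> outw w U (Q y) + sum m (Q y) + 2 \<le> sum m U"
    using contracted_degree_bound[OF IH finU wg sum' unsat' size' tame] by metis
  have yU: "y \<in> U" using y by (simp add: U_def)
  \<comment> \<open>The boundary of the part of \<open>y\<close>. The 3 in the bound below is the 2
    of (a) plus the lost tip edge of \<open>x\<close>.\<close>
  define k where "k = outw w U (Q y) + sum m (Q y)"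
  have "k + 3 \<le> sum c V + card Y" using Q[OF yU] sm by (simp add: k_def)
  moreover have "2 \<le> card (Q y) \<or> Q y = {y}"
    using Q[OF yU] card_ge2_or_singleton[of "Q y" y] finU finite_subset[of "Q y" U] by auto
  then have "6 \<le> k \<and> D y \<le> k \<or> k + w x y = D y + (if y \<in> Y then 1 else 0)"
  proof
    assume "2 \<le> card (Q y)"
    then show ?thesis using big[of "Q y"] Q[OF yU] by (simp add: k_def)
  next
    assume "Q y = {y}"
    then show ?thesis using single[OF yU] D_eq[of y] by (simp add: k_def m_def)
  qed
  ultimately show ?thesis by blast
qed

text \<open>If the bound fails at \<open>v\<close>, no edge avoiding \<open>v\<close> can be deleted
  without raising the tip demand, as \<open>delete_edge_bound\<close> would give the bound at
  \<open>v\<close>. So adjacent vertices other than \<open>v\<close> are never good for opposite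
  signs, and these vertices fall into two sign classes with no edge between them.\<close>

lemma full_degree_le_tip_demand:
  assumes v: "v \<in> V" shows "D v + 2 \<le> sum c V"
proof (rule ccontr)
  assume neg: "\<not> D v + 2 \<le> sum c V"
  define W where "W = V - {v}"
  have finW: "finite W" using fin by (simp add: W_def)
  have Wp: "W \<subset> V" "2 \<le> card W" using compl_proper[OF v] by (auto simp: W_def)
  have no: "\<not> (good s x \<and> good (- s) u)" if "x \<in> W" "u \<in> W" "w x u = 1" "s \<noteq> 0" for x u s
    using delete_edge_bound[of u x s] that neg v by (auto simp: W_def)
  have nbr: "\<exists>u\<in>W. w x u = 1" if x: "x \<in> W" for x
  proof (rule ccontr)
    assume "\<not> ?thesis"
    then have "nbrs x \<subseteq> {v}" by (auto simp: nbrs_def W_def)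
    then have "card (nbrs x) \<le> 1" using card_mono[of "{v}" "nbrs x"] by simp
    then show False using d_card[of x] d_ge3[of x] x by (simp add: W_def)
  qed
  have one: "\<not> (good 1 x \<and> good (-1) x)" if x: "x \<in> W" for x
  proof
    assume *: "good 1 x \<and> good (-1) x"
    obtain u where u: "u \<in> W" "w x u = 1" using nbr[OF x] by blast
    then show False using good_exists[of u] no[OF x u, of 1] no[OF x u, of "-1"] * by (auto simp: W_def)
  qed
  define C where "C = {x \<in> W. good 1 x}"
  define C' where "C' = {x \<in> W. good (-1) x}"
  have CC: "W = C \<union> C'" "C \<inter> C' = {}" using good_exists one by (auto simp: C_def C'_def W_def)
  have noedge: "w x y = 0" if "x \<in> C" "y \<in> C'" for x y
    using no[of x y 1] simple[of x y] that by (auto simp: C_def C'_def W_def le_Suc_eq)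
  have noedge': "w y x = 0" if "x \<in> C" "y \<in> C'" for x y
    using noedge[OF that] wsym[of y x] by simp
  have fC: "finite C" "finite C'" using CC finW by auto
  have vC: "v \<notin> C" "v \<notin> C'" using CC by (auto simp: W_def)
  have Vv: "V = insert v (C \<union> C')" using CC v by (auto simp: W_def)
  \<comment> \<open>The cuts around the two classes, each enlarged by \<open>v\<close>, add up to
    \<open>D v + sum c V\<close>. By (a) each is at least \<open>D v + 2\<close>, which restores the
    violated bound.\<close>
  have empty: "C = {} \<or> C' = {}"
  proof (rule ccontr)
    assume ne: "\<not> ?thesis"
    have p: "insert v C \<subset> V" "2 \<le> card (insert v C)" "insert v C' \<subset> V" "2 \<le> card (insert v C')"
      using ne Vv vC CC fC by (auto simp: Suc_le_eq card_gt_0_iff)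
    have e: "V - insert v C = C'" "V - insert v C' = C" using Vv vC CC by auto
    have "outw w V (insert v C) = (\<Sum>y\<in>C'. w v y)"
      unfolding outw_def e using fC vC noedge by simp
    then have 1: "D v + 2 \<le> (\<Sum>y\<in>C'. w v y) + c v + sum c C"
      using bd_ge[OF p(1,2), of v] fC vC by (simp add: bd_def)
    have "outw w V (insert v C') = (\<Sum>y\<in>C. w v y)"
      unfolding outw_def e using fC vC noedge noedge' by simp
    then have 2: "D v + 2 \<le> (\<Sum>y\<in>C. w v y) + c v + sum c C'"
      using bd_ge[OF p(3,4), of v] fC vC by (simp add: bd_def)
    have spl: "sum h V = h v + (sum h C + sum h C')" for h :: "'a \<Rightarrow> nat"
      unfolding Vv using fC vC CC(2) by (simp add: sum.union_disjoint)
    have "d v = (\<Sum>y\<in>C. w v y) + (\<Sum>y\<in>C'. w v y)" using spl[of "w v"] by (simp add: d_def)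
    moreover have "sum c V = c v + sum c C + sum c C'" using spl[of c] by simp
    ultimately show False using 1 2 D_eq[of v] neg by linarith
  qed
  obtain s where s: "s \<noteq> 0" "\<And>x. x \<in> W \<Longrightarrow> good s x \<and> \<not> good (- s) x"
  proof (cases "C = {}")
    case True
    then show ?thesis using that[of "-1"] good_exists by (auto simp: C_def W_def)
  next
    case False
    then show ?thesis using that[of 1] empty good_exists by (auto simp: C'_def W_def)
  qed
  have type: "d x = 4 \<and> r x = s \<or> d x = 5 \<and> r x = - s \<or> d x = 6 \<and> r x = s" if "x \<in> W" for x
    using good_unique[of x s] s that by (auto simp: W_def)
  show False
  proof (cases "\<exists>x\<in>W. d x = 4")
    case True
    then obtain x where x: "x \<in> W" "d x = 4" by blast
    then have "r x = s" using type[of x] by auto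
    \<comment> \<open>Only \<open>v\<close> may fail to be good for \<open>s\<close>, so it receives
      the tip edge freed by \<open>x\<close>.\<close>
    have "\<exists>k. k + 3 \<le> sum c V + card {v} \<and> (6 \<le> k \<and> D v \<le> k \<or> k + w x v = D v + (if v \<in> {v} then 1 else 0))"
      using x v s \<open>r x = s\<close> by (intro remove_degree_4_vertex[of x s "{v}" v]) (auto simp: W_def)
    then show False using neg simple[of x v] x v by (auto simp: W_def)
  next
    case False
    \<comment> \<open>Without degree 4 all tip demand sits at \<open>v\<close>. The cut around
      \<open>V - {x}\<close> then gives \<open>d v\<close> at most 4, while the cut around
      \<open>W\<close> has size \<open>d v\<close> and must be at least 8.\<close>
    then have c0: "c x = 0" "d x \<le> 6" if "x \<in> W" for x
      using type[OF that] that s by (auto simp: c_def tip_demand_def)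
    have M: "sum c V = c v" using c0 v fin by (simp add: sum.remove W_def)
    obtain x where x: "x \<in> W" using Wp by fastforce
    have "D v + 2 \<le> bd (V - {x})" using x v compl_proper[of x] by (intro bd_ge) (auto simp: W_def)
    then have "D v + 2 \<le> d x + c v" using bd_compl[of x] x c0 M by (simp add: W_def)
    moreover have "bd W = d v" using bd_compl[OF v] M by (simp add: W_def)
    ultimately show False using bd_ge8[OF Wp] D_eq[of v] c0[OF x] by linarith
  qed
qed

text \<open>Stronger than (b). At total 7, (a) makes all full degrees 5; deleting an edge would
  leave at least two further vertices of full degree 5, against (b). So again all vertices have a
  common sign.\<close>

lemma tip_demand_neq_7:
  assumes M: "sum c V = 7" shows False
proof -
  have D5': "D x = 5" if "x \<in> V" for x using full_degree_le_tip_demand[OF that] D5[OF that] M by simp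
  have card4: "4 \<le> card V"
  proof -
    obtain x where x: "x \<in> V" using card3 by fastforce
    have "card (nbrs x) \<le> card (V - {x})" using nbrs_subset fin by (intro card_mono) auto
    then show ?thesis using d_card[OF x] d_ge3[OF x] x fin by (simp add: card_Diff_singleton)
  qed
  have no: "\<not> (good s x \<and> good (- s) u)" if xu: "x \<in> V" "u \<in> V" "w x u = 1" "s \<noteq> 0" for x u s
  proof
    assume "good s x \<and> good (- s) u"
    then have *: "\<forall>y\<in>V - {u, x}. \<forall>y'\<in>V - {u, x}. y = y'" using delete_edge_bound[of u x s] xu M by blast
    have "card (V - {u, x}) \<ge> 2"
      using card4 fin xu card_Diff_subset[of "{u,x}" V] card_insert_le_m1[of 2 "{x}" u] by auto
    then obtain y where y: "y \<in> V - {u, x}" by (metis card.empty ex_in_conv not_numeral_le_zero)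
    then have "V - {u, x} = {y}" using * by blast
    then show False using \<open>card (V - {u, x}) \<ge> 2\<close> by simp
  qed
  have one: "\<not> (good 1 x \<and> good (-1) x)" if x: "x \<in> V" for x
  proof
    assume *: "good 1 x \<and> good (-1) x"
    have "nbrs x \<noteq> {}" using d_card[OF x] d_ge3[OF x] by auto
    then obtain u where u: "u \<in> V" "w x u = 1" by (auto simp: nbrs_def)
    then show False using good_exists[of u] no[OF x u, of 1] no[OF x u, of "-1"] * by auto
  qed
  define C where "C = {x \<in> V. good 1 x}"
  define C' where "C' = {x \<in> V. good (-1) x}"
  have CC: "V = C \<union> C'" "C \<inter> C' = {}" using good_exists one by (auto simp: C_def C'_def)
  have noedge: "w x y = 0" if "x \<in> C" "y \<in> C'" for x y
    using no[of x y 1] simple[of x y] that by (auto simp: C_def C'_def le_Suc_eq)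
  have noedge': "w y x = 0" if "x \<in> C" "y \<in> C'" for x y
    using noedge[OF that] wsym[of y x] by simp
  have fC: "finite C" "finite C'" using CC fin by (metis finite_Un)+
  have bd5: "5 \<le> bd A" if A: "A \<subset> V" "x \<in> A" for A x
    using card_ge2_or_singleton[OF finite_sub A(2)] A bd_ge8[of A] bd_single[of x] D5[of x] by auto
  \<comment> \<open>No edge joins the classes, so their cuts add up to 7, though each is at least
    5.\<close>
  have empty: "C = {} \<or> C' = {}"
  proof (rule ccontr)
    assume ne: "\<not> ?thesis"
    then have p: "C \<subset> V" "C' \<subset> V" using CC by auto
    have e: "V - C = C'" "V - C' = C" using CC by auto
    have "outw w V C = 0" unfolding outw_def e using noedge by simp
    moreover have "outw w V C' = 0" unfolding outw_def e using noedge' by simp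
    moreover have "sum c V = sum c C + sum c C'" using CC fC by (metis sum.union_disjoint)
    ultimately show False using bd5[OF p(1)] bd5[OF p(2)] ne M by (fastforce simp: bd_def)
  qed
  obtain s where s: "s \<noteq> 0" "\<And>x. x \<in> V \<Longrightarrow> good s x \<and> \<not> good (- s) x"
  proof (cases "C = {}")
    case True
    then show ?thesis using that[of "-1"] good_exists by (auto simp: C_def)
  next
    case False
    then show ?thesis using that[of 1] empty good_exists by (auto simp: C'_def)
  qed
  have type: "d x = 4 \<and> r x = s \<or> d x = 5 \<and> r x = - s" if "x \<in> V" for x
    using good_unique[of x s] s that D5'[OF that] by (auto simp: D_def full_degree_def)
  have c1: "c x \<le> 1" if "x \<in> V" for x using type[OF that] D5'[OF that] D_eq[of x] by auto
  have "sum c V \<le> card V" using sum_mono[of V c "\<lambda>_. 1"] c1 by simp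
  then have card7: "7 \<le> card V" using M by simp
  obtain x where x: "x \<in> V" "d x = 4"
  proof -
    obtain x where "x \<in> V" "c x \<noteq> 0" using M by (metis sum.neutral zero_neq_numeral)
    then show ?thesis using that[of x] type[of x] D5'[of x] D_eq[of x] by auto
  qed
  \<comment> \<open>With no extra tip edge \<open>k\<close> is at most 4, so \<open>D y = 5\<close>
    forces adjacency; then \<open>x\<close> of degree 4 would have at least six neighbours.\<close>
  have "w x y = 1" if y: "y \<in> V - {x}" for y
  proof -
    have "\<exists>k. k + 3 \<le> sum c V + card ({}::'a set) \<and> (6 \<le> k \<and> D y \<le> k \<or> k + w x y = D y + (if y \<in> {} then 1 else 0))"
      using x s type[OF x(1)] y by (intro remove_degree_4_vertex[of x s "{}" y]) auto
    then show ?thesis using M D5'[of y] y simple[of x y] x by auto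
  qed
  then have "V - {x} \<subseteq> nbrs x" by (auto simp: nbrs_def)
  then have "card (V - {x}) \<le> 4" using d_card[OF x(1)] x(2) card_mono[of "nbrs x" "V - {x}"] fin by (simp add: nbrs_def)
  then show False using card7 x fin by (simp add: card_Diff_singleton)
qed

end

section \<open>The degree bound and its application to canvases\<close>

lemma satisfiable_small:
  assumes "finite V" "card V \<le> 1" "wgraph w" "sum r V = 0"
  shows "satisfiable V w r"
proof (cases "V = {}")
  case False
  then have "card V = 1" using assms by (metis One_nat_def Suc_leI card_gt_0_iff le_antisym)
  then obtain x where "V = {x}" by (rule card_1_singletonE)
  then show ?thesis using assms unfolding satisfiable_def wgraph_def
    by (intro exI[of _ "\<lambda>_ _. 0"]) (auto simp: allowed_def)
qed (simp add: satisfiable_def)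

lemma critical_pair:
  assumes crit: "critical V w r" and V: "V = {x, y}" "x \<noteq> y"
  shows "w x y \<le> 1"
proof (rule ccontr)
  assume neg: "\<not> ?thesis"
  have wg: "wgraph w" and r: "r x + r y = 0" and unsat: "\<not> satisfiable V w r"
    using crit V by (auto simp: critical_def)
  define f where "f a b = (if a = x \<and> b = y then r x else if a = y \<and> b = x then r y else 0)" for a b
  have ry: "r y = - r x" using r by (simp add: eq_neg_iff_add_eq_0 add.commute)
  have "w y x = w x y" "w x x = 0" "w y y = 0" using wg by (auto simp: wgraph_def)
  then have "satisfiable V w r"
    unfolding satisfiable_def V using V(2) ry neg
    by (intro exI[of _ f]) (auto simp: f_def allowed_def)
  then show False using unsat by simp
qed

theorem critical_degree_bound:
  fixes w :: "'v \<Rightarrow> 'v \<Rightarrow> nat"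
  assumes "critical V w r"
  shows "degree_bound V (\<lambda>x. full_degree (\<Sum>y\<in>V. w x y) (r x)) (\<Sum>x\<in>V. tip_demand (\<Sum>y\<in>V. w x y) (r x))"
  using assms
proof (induction "total_size V w" arbitrary: V w r rule: less_induct)
  case less
  note crit = less.prems
  have fin: "finite V" and wg: "wgraph w" and unsat: "\<not> satisfiable V w r" and r0: "sum r V = 0"
    using crit by (auto simp: critical_def)
  have "\<not> card V \<le> 1" using satisfiable_small[OF fin _ wg r0] unsat by blast
  then consider "card V = 2" | "3 \<le> card V" by linarith
  then show ?case
  proof cases
    case 1
    then obtain x y where V: "V = {x, y}" "x \<noteq> y" by (auto simp: card_2_iff)
    have w0: "w y x = w x y" "w x x = 0" "w y y = 0" using wg by (auto simp: wgraph_def)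
    \<comment> \<open>Both full degrees are 4 and the total demand is 6 or 8, so (a) is tight for an
      edge and (b) is vacuous.\<close>
    have le: "w x y \<le> 1" using critical_pair[OF crit V] .
    then have "full_degree (w x y) a = 4" "tip_demand (w x y) a = 4 - w x y" for a
      by (auto simp: full_degree_def tip_demand_def)
    then show ?thesis using le V(2) unfolding degree_bound_def V(1) by (simp add: w0)
  next
    case 2
    interpret S: critical_step V w r
      by unfold_locales (rule crit, rule less.hyps, assumption+, rule 2)
    have "degree_bound V S.D (sum S.c V)"
    proof (cases "\<exists>x\<in>V. S.D x = 4")
      case True
      then show ?thesis using S.degree_bound_if_4 by blast
    next
      case False
      interpret S5: critical_step5 V w r
      proof
        fix x assume "x \<in> V"
        then show "5 \<le> S.D x" using False S.D_ge4[of x] by fastforce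
      qed
      show ?thesis unfolding degree_bound_def using S5.full_degree_le_tip_demand S5.tip_demand_neq_7 by blast
    qed
    then show ?thesis by (simp add: S.D_def[abs_def] S.c_def[abs_def] S.d_def[abs_def])
  qed
qed

lemma set_degree_bound_of_locally_unsat:
  assumes "wgraph w" "finite A" "2 \<le> card A"
    and "\<And>B. B \<subseteq> A \<Longrightarrow> 2 \<le> card B \<Longrightarrow> locally_unsat w D B"
  shows "degree_bound A D (\<Sum>x\<in>A. D x - (\<Sum>y\<in>A. w x y))"
  by (rule set_degree_bound[OF critical_degree_bound assms(1-3) lessI assms(4)])

section \<open>Orientations of multigraphs as flows on weighted graphs\<close>

definition edge_mult :: "('v, 'e) multigraph \<Rightarrow> 'v \<Rightarrow> 'v \<Rightarrow> nat" where
  "edge_mult G x y = (if x = y then 0 else card {e \<in> edges G. ends G e = {x, y}})"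

lemma wgraph_edge_mult: "wgraph (edge_mult G)"
  by (auto simp: wgraph_def edge_mult_def insert_commute)

lemma ends_cases:
  assumes "wf_multigraph G" "e \<in> edges G" "x \<in> ends G e"
  obtains y where "ends G e = {x, y}" "y \<noteq> x" "x \<in> verts G" "y \<in> verts G"
proof -
  have "card (ends G e) = 2" "ends G e \<subseteq> verts G" using assms by (auto simp: wf_multigraph_def)
  then obtain a b where "ends G e = {a, b}" "a \<noteq> b" by (auto simp: card_2_iff)
  then show ?thesis using that[of a] that[of b] assms(3) \<open>ends G e \<subseteq> verts G\<close> by auto
qed

lemma finite_incident: "wf_multigraph G \<Longrightarrow> finite (incident_edges G x)"
  by (simp add: wf_multigraph_def incident_edges_def)

lemma sum_incident:
  fixes phi :: "'e \<Rightarrow> 'b::comm_monoid_add"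
  assumes wf: "wf_multigraph G" and A: "A \<subseteq> verts G" "x \<in> A"
  shows "sum phi {e \<in> incident_edges G x. ends G e \<subseteq> A} = (\<Sum>y\<in>A - {x}. sum phi {e \<in> edges G. ends G e = {x, y}})"
proof -
  have fin: "finite (verts G)" "finite (edges G)" using wf by (auto simp: wf_multigraph_def)
  have "{e \<in> incident_edges G x. ends G e \<subseteq> A} = (\<Union>y\<in>A - {x}. {e \<in> edges G. ends G e = {x, y}})"
  proof (intro equalityI subsetI)
    fix e assume "e \<in> {e \<in> incident_edges G x. ends G e \<subseteq> A}"
    then have e: "e \<in> edges G" "x \<in> ends G e" "ends G e \<subseteq> A" by (auto simp: incident_edges_def)
    obtain y where "ends G e = {x, y}" "y \<noteq> x" using ends_cases[OF wf e(1,2)] by blast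
    then show "e \<in> (\<Union>y\<in>A - {x}. {e \<in> edges G. ends G e = {x, y}})" using e by auto
  qed (use A in \<open>auto simp: incident_edges_def\<close>)
  also have "sum phi \<dots> = (\<Sum>y\<in>A - {x}. sum phi {e \<in> edges G. ends G e = {x, y}})"
    using fin A finite_subset[OF A(1)] by (intro sum.UNION_disjoint) (auto simp: doubleton_eq_iff)
  finally show ?thesis .
qed

lemma sum_edge_mult:
  assumes wf: "wf_multigraph G" and A: "A \<subseteq> verts G" "x \<in> A"
  shows "(\<Sum>y\<in>A. edge_mult G x y) = card {e \<in> incident_edges G x. ends G e \<subseteq> A}"
proof -
  have finA: "finite A" using wf A finite_subset by (auto simp: wf_multigraph_def)
  have "card {e \<in> incident_edges G x. ends G e \<subseteq> A} = (\<Sum>y\<in>A - {x}. edge_mult G x y)"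
  proof -
    have "(\<Sum>y\<in>A - {x}. edge_mult G x y) = (\<Sum>y\<in>A - {x}. sum (\<lambda>_. 1::nat) {e \<in> edges G. ends G e = {x, y}})"
      by (intro sum.cong refl) (auto simp: edge_mult_def)
    then show ?thesis using sum_incident[OF wf A, of "\<lambda>_. 1::nat"] by simp
  qed
  then show ?thesis using finA A by (simp add: sum.remove edge_mult_def)
qed

lemma degree_edge_mult:
  assumes wf: "wf_multigraph G" and x: "x \<in> verts G"
  shows "degree G x = (\<Sum>y\<in>verts G. edge_mult G x y)"
proof -
  have "{e \<in> incident_edges G x. ends G e \<subseteq> verts G} = incident_edges G x"
    using wf by (auto simp: wf_multigraph_def incident_edges_def)
  then show ?thesis using sum_edge_mult[OF wf _ x] by (simp add: degree_def)
qed

definition sgn_at :: "('e \<Rightarrow> 'v) \<Rightarrow> 'v \<Rightarrow> 'e \<Rightarrow> Z3" where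
  "sgn_at h x e = (if h e = x then -1 else 1)"

lemma balanced_at_sgn:
  assumes "finite (incident_edges G x)"
  shows "balanced_at G \<beta> h x \<longleftrightarrow> (\<Sum>e\<in>incident_edges G x. sgn_at h x e) = \<beta> x"
proof -
  have "(\<Sum>e\<in>incident_edges G x. sgn_at h x e) =
    (\<Sum>e\<in>{e \<in> incident_edges G x. h e \<noteq> x}. 1) + (\<Sum>e\<in>{e \<in> incident_edges G x. h e = x}. - 1)"
  proof -
    have "(\<Sum>e\<in>incident_edges G x. sgn_at h x e) = (\<Sum>e\<in>{e \<in> incident_edges G x. h e \<noteq> x} \<union> {e \<in> incident_edges G x. h e = x}. sgn_at h x e)"
      by (intro sum.cong) auto
    also have "\<dots> = (\<Sum>e\<in>{e \<in> incident_edges G x. h e \<noteq> x}. sgn_at h x e) + (\<Sum>e\<in>{e \<in> incident_edges G x. h e = x}. sgn_at h x e)"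
      using assms by (intro sum.union_disjoint) auto
    finally show ?thesis by (simp add: sgn_at_def)
  qed
  then show ?thesis unfolding balanced_at_def outdegree_def indegree_def by simp
qed

text \<open>Tame means degree at least 6, or 5 with nonzero boundary value, or 4 with value 0:
  exactly the cases with tip demand 0.\<close>

lemma full_degree_tame:
  assumes "4 + (if even n then (if a = 0 then 0 else 2) else (if a = 0 then 3 else 1)) \<le> n"
  shows "full_degree n a \<le> n"
proof -
  consider "n \<le> 3" | "n = 4" | "n = 5" | "6 \<le> n" by linarith
  then show ?thesis
    by cases (use assms in \<open>auto simp: full_degree_def tip_demand_def split: if_splits\<close>)
qed

lemma tame_full_degree:
  assumes "tame G \<beta> z" "x \<in> verts G - {z}" "wf_multigraph G"
  shows "full_degree (degree G x) (\<beta> x) \<le> degree G x"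
proof -
  have fe: "{e \<in> edges G. card (ends G e \<inter> {x}) = 1} = incident_edges G x"
    by (auto simp: incident_edges_def Int_insert_right split: if_splits)
  have sx: "sum \<beta> {x} = \<beta> x" by simp
  have "4 + abs_tau G \<beta> {x} \<le> degree G x" using assms by (auto simp: tame_def)
  then show ?thesis
    unfolding abs_tau_def set_degree_def fe degree_def[symmetric] sx by (rule full_degree_tame)
qed

lemma orient_pairs:
  assumes wf: "wf_multigraph G" and A: "A \<subseteq> verts G"
    and f: "\<And>x y. x \<in> A \<Longrightarrow> y \<in> A \<Longrightarrow> f x y = - f y x"
      "\<And>x y. x \<in> A \<Longrightarrow> y \<in> A \<Longrightarrow> allowed (edge_mult G x y) (f x y)"
  shows "\<exists>h. (\<forall>e\<in>edges G. ends G e \<subseteq> A \<longrightarrow> h e \<in> ends G e) \<and>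
    (\<forall>x\<in>A. (\<Sum>e\<in>{e \<in> incident_edges G x. ends G e \<subseteq> A}. sgn_at h x e) = (\<Sum>y\<in>A. f x y))"
proof -
  have finE: "finite (edges G)" and finA: "finite A" using wf A finite_subset by (auto simp: wf_multigraph_def)
  define E where "E S = {e \<in> edges G. ends G e = S}" for S
  have "\<exists>p. card S = 2 \<longrightarrow> S = {fst p, snd p}" for S :: "'a set"
    by (metis card_2_iff fst_conv snd_conv)
  then obtain p where p: "\<And>S::'a set. card S = 2 \<Longrightarrow> S = {fst (p S), snd (p S)}" by metis
  \<comment> \<open>\<open>t S\<close> and \<open>b S\<close> fix a reference direction on the
    unordered pair \<open>S\<close>; an edge of value 1 points to \<open>b S\<close>, one of value
    -1 to \<open>t S\<close>.\<close>
  define t where "t S = fst (p S)" for S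
  define b where "b S = snd (p S)" for S
  have tb: "t {x, y} = x \<and> b {x, y} = y \<or> t {x, y} = y \<and> b {x, y} = x" if "x \<noteq> y" for x y
    using p[of "{x, y}"] that unfolding t_def b_def doubleton_eq_iff by auto
  have "\<exists>g. (\<forall>e\<in>E S. allowed (1::nat) (g e)) \<and> (\<Sum>e\<in>E S. g e) = f (t S) (b S)"
    if "S = {x, y}" "x \<in> A" "y \<in> A" "x \<noteq> y" for S x y
  proof -
    have S: "{t S, b S} = S" "t S \<noteq> b S" "t S \<in> A" "b S \<in> A" using tb[of x y] that by auto
    have "edge_mult G (t S) (b S) = (\<Sum>e\<in>E S. 1)" using S(2) by (simp add: edge_mult_def E_def S(1))
    then show ?thesis using f(2)[OF S(3,4)] finE
      by (intro allowed_sum_split) (auto simp: E_def)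
  qed
  then have "\<forall>S. \<exists>g. (\<exists>x\<in>A. \<exists>y\<in>A. x \<noteq> y \<and> S = {x, y}) \<longrightarrow>
      (\<forall>e\<in>E S. allowed (1::nat) (g e)) \<and> (\<Sum>e\<in>E S. g e) = f (t S) (b S)" by blast
  then obtain g where g: "\<And>S. \<exists>x\<in>A. \<exists>y\<in>A. x \<noteq> y \<and> S = {x, y} \<Longrightarrow>
      (\<forall>e\<in>E S. allowed (1::nat) (g S e)) \<and> (\<Sum>e\<in>E S. g S e) = f (t S) (b S)" by metis
  define h where "h e = (if g (ends G e) e = 1 then b (ends G e) else t (ends G e))" for e
  have "h e \<in> ends G e" if e: "e \<in> edges G" for e
  proof -
    have "card (ends G e) = 2" using wf e by (auto simp: wf_multigraph_def)
    then obtain x y where "ends G e = {x, y}" "x \<noteq> y" by (auto simp: card_2_iff)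
    then show ?thesis using tb[of x y] by (auto simp: h_def)
  qed
  moreover have "(\<Sum>e\<in>{e \<in> incident_edges G x. ends G e \<subseteq> A}. sgn_at h x e) = (\<Sum>y\<in>A. f x y)" if x: "x \<in> A" for x
  proof -
    have "sum (sgn_at h x) {e \<in> edges G. ends G e = {x, y}} = f x y" if y: "y \<in> A - {x}" for y
    proof -
      have gS: "\<forall>e\<in>E {x, y}. g {x, y} e \<noteq> 0" "(\<Sum>e\<in>E {x, y}. g {x, y} e) = f (t {x, y}) (b {x, y})"
        using g[of "{x, y}"] x y by (auto simp: allowed_def)
      have pm: "g {x, y} e = 1 \<or> g {x, y} e = -1" if "e \<in> E {x, y}" for e
        using gS(1) that Z3_cases[of "g {x, y} e"] by auto
      have "x \<noteq> y" using y by auto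
      from tb[OF this] show ?thesis
      proof
        assume *: "t {x, y} = x \<and> b {x, y} = y"
        have "sum (sgn_at h x) (E {x, y}) = (\<Sum>e\<in>E {x, y}. g {x, y} e)"
        proof (intro sum.cong refl)
          fix e assume e: "e \<in> E {x, y}"
          then have "ends G e = {x, y}" by (simp add: E_def)
          then show "sgn_at h x e = g {x, y} e" using pm[OF e] * y by (auto simp: sgn_at_def h_def)
        qed
        then show ?thesis using gS * by (simp add: E_def)
      next
        assume *: "t {x, y} = y \<and> b {x, y} = x"
        have "sum (sgn_at h x) (E {x, y}) = (\<Sum>e\<in>E {x, y}. - g {x, y} e)"
        proof (intro sum.cong refl)
          fix e assume e: "e \<in> E {x, y}"
          then have "ends G e = {x, y}" by (simp add: E_def)
          then show "sgn_at h x e = - g {x, y} e" using pm[OF e] * y by (auto simp: sgn_at_def h_def)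
        qed
        then show ?thesis using gS * f(1)[of x y] x y by (simp add: E_def sum_negf)
      qed
    qed
    moreover have "f x x = 0" using f(1)[OF x x] by (simp only: Z3_eq_uminus)
    ultimately show ?thesis using sum_incident[OF wf A x, of "sgn_at h x"] finA x by (simp add: sum.remove)
  qed
  ultimately show ?thesis by blast
qed

text \<open>Contract \<open>A\<close> alone and take a preflow that extends to the contraction but
  not to \<open>G\<close>. The flow on the contraction leaves a residual demand \<open>q\<close> on
  \<open>A\<close>; meeting it inside \<open>A\<close> would lift the flow to
  \<open>G\<close>.\<close>

lemma locally_unsat_of_flow_critical:
  assumes wf: "wf_multigraph G" and z: "z \<in> verts G" and crit: "flow_critical G \<beta> z" and tame: "tame G \<beta> z"
    and A: "A \<subseteq> verts G - {z}" "2 \<le> card A"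
  shows "locally_unsat (edge_mult G) (degree G) A"
proof -
  have AV: "A \<subseteq> verts G" using A by auto
  have finE: "finite (edges G)" and finA: "finite A" using wf AV finite_subset by (auto simp: wf_multigraph_def)
  define P where "P = insert A ((\<lambda>x. {x}) ` (verts G - A))"
  have Ane: "A \<noteq> {}" using A by auto
  have part_in: "part_of P x = A" if "x \<in> A" for x
    unfolding part_of_def using that by (intro the_equality) (auto simp: P_def)
  have part_out: "part_of P x = {x}" if "x \<in> verts G - A" for x
    unfolding part_of_def using that by (intro the_equality) (auto simp: P_def)
  have Asing: "A \<noteq> {x}" for x using A by auto
  have "partition_on (verts G) P"
    using AV Ane by (auto simp: partition_on_def P_def disjoint_def)
  moreover have "{z} \<in> P" using A z by (auto simp: P_def)
  moreover have "nontrivial_partition P" using A by (auto simp: nontrivial_partition_def P_def)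
  ultimately obtain \<psi> where psi: "tip_preflow G \<beta> z \<psi>"
    and ext: "extends_to_flow (contract G P) (contract_boundary \<beta>) {z} (contract_orientation P \<psi>)"
    and noext: "\<not> extends_to_flow G \<beta> z \<psi>"
    using crit unfolding flow_critical_def tip_respecting_def by blast
  define K where "K = contract G P"
  obtain h where flow: "nowhere_zero_flow K (contract_boundary \<beta>) h"
    and agree: "\<And>e. e \<in> incident_edges K {z} \<Longrightarrow> h e = contract_orientation P \<psi> e"
    using ext unfolding extends_to_flow_def K_def by blast
  have endsG: "card (ends G e) = 2" "ends G e \<subseteq> verts G" if "e \<in> edges G" for e
    using wf that by (auto simp: wf_multigraph_def)
  have edgesK: "edges K = {e \<in> edges G. \<not> ends G e \<subseteq> A}"
  proof -
    have "\<not> ends G e \<subseteq> {x}" if "e \<in> edges G" for e x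
      using card_mono[of "{x}" "ends G e"] endsG(1)[OF that] by auto
    then show ?thesis by (auto simp: K_def contract_def P_def)
  qed
  have endsK: "ends K e = part_of P ` ends G e" for e by (simp add: K_def contract_def)
  have vertsK: "verts K = P" by (simp add: K_def contract_def)
  have finK: "finite (incident_edges K p)" for p
    using finE by (auto simp: incident_edges_def edgesK)
  \<comment> \<open>A surviving edge has its ends in different parts, so its head in the contraction
    determines its head in \<open>G\<close>.\<close>
  have inj: "u = v" if eK: "e \<in> edges K" and u: "u \<in> ends G e" and v: "v \<in> ends G e"
    and eq: "part_of P u = part_of P v" for e u v
  proof (rule ccontr)
    assume ne: "u \<noteq> v"
    have e: "e \<in> edges G" "\<not> ends G e \<subseteq> A" using eK edgesK by auto
    obtain y where y: "ends G e = {u, y}" using ends_cases[OF wf e(1) u] by blast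
    then have uv: "ends G e = {u, v}" using v ne by auto
    then have V: "u \<in> verts G" "v \<in> verts G" using endsG[OF e(1)] by auto
    show False using eq part_in[of u] part_in[of v] part_out[of u] part_out[of v] V ne uv e Asing
      by (cases "u \<in> A"; cases "v \<in> A") auto
  qed
  have hin: "h e \<in> part_of P ` ends G e" if "e \<in> edges K" for e
    using flow that by (auto simp: nowhere_zero_flow_def orientation_on_def endsK)
  have bal: "(\<Sum>e\<in>incident_edges K p. sgn_at h p e) = sum \<beta> p" if "p \<in> P" for p
    using flow that balanced_at_sgn[OF finK] by (simp add: nowhere_zero_flow_def vertsK contract_boundary_def)
  define out where "out x = {e \<in> incident_edges G x. \<not> ends G e \<subseteq> A}" for x
  define q where "q x = \<beta> x - (\<Sum>e\<in>out x. sgn_at h A e)" for x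
  have fino: "finite (out x)" for x using finE by (simp add: out_def incident_edges_def)
  have incA: "incident_edges K A = (\<Union>x\<in>A. out x)"
  proof (intro equalityI subsetI)
    fix e assume "e \<in> incident_edges K A"
    then have e: "e \<in> edges G" "\<not> ends G e \<subseteq> A" "A \<in> part_of P ` ends G e"
      by (auto simp: incident_edges_def edgesK endsK)
    then obtain x where x: "x \<in> ends G e" "part_of P x = A" by auto
    then have "x \<in> A" using part_out[of x] endsG[OF e(1)] Asing[of x] by (cases "x \<in> A") auto
    then show "e \<in> (\<Union>x\<in>A. out x)" using e x by (auto simp: out_def incident_edges_def)
  next
    fix e assume "e \<in> (\<Union>x\<in>A. out x)"
    then obtain x where "x \<in> A" "e \<in> edges G" "x \<in> ends G e" "\<not> ends G e \<subseteq> A" by (auto simp: out_def incident_edges_def)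
    then show "e \<in> incident_edges K A" using part_in[of x] by (auto simp: incident_edges_def edgesK endsK)
  qed
  have disj: "out x \<inter> out y = {}" if "x \<in> A" "y \<in> A" "x \<noteq> y" for x y
  proof -
    have False if "e \<in> out x" "e \<in> out y" for e
      using inj[of e x y] that \<open>x \<in> A\<close> \<open>y \<in> A\<close> \<open>x \<noteq> y\<close> part_in by (auto simp: out_def incident_edges_def edgesK)
    then show ?thesis by blast
  qed
  have "(\<Sum>x\<in>A. \<Sum>e\<in>out x. sgn_at h A e) = (\<Sum>e\<in>incident_edges K A. sgn_at h A e)"
    unfolding incA using finA fino disj by (intro sum.UNION_disjoint[symmetric]) auto
  then have q0: "sum q A = 0" using bal[of A] by (simp add: q_def sum_subtractf P_def)
  have need: "full_degree (\<Sum>y\<in>A. edge_mult G x y) (q x) \<le> degree G x" if x: "x \<in> A" for x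
  proof -
    have "allowed (\<Sum>e\<in>out x. 1) (\<Sum>e\<in>out x. sgn_at h A e)"
      by (rule allowed_sum[OF fino]) (simp add: sgn_at_def allowed_def)
    then have al: "allowed (card (out x)) (- (\<Sum>e\<in>out x. sgn_at h A e))" by simp
    have "card (incident_edges G x) = card {e \<in> incident_edges G x. ends G e \<subseteq> A} + card (out x)"
      unfolding out_def using finite_incident[OF wf, of x]
      by (subst card_Un_disjoint[symmetric]) (auto intro!: arg_cong[of _ _ card])
    then have deg: "degree G x = (\<Sum>y\<in>A. edge_mult G x y) + card (out x)"
      using sum_edge_mult[OF wf AV x] by (simp add: degree_def)
    have xV: "x \<in> verts G - {z}" using x A by auto
    show ?thesis using full_degree_allowed[OF al, of "\<Sum>y\<in>A. edge_mult G x y" "\<beta> x"]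
        tame_full_degree[OF tame xV wf] deg by (simp add: q_def)
  qed
  have "\<not> satisfiable A (edge_mult G) q"
  proof
    assume "satisfiable A (edge_mult G) q"
    then obtain f where f: "\<And>x y. x \<in> A \<Longrightarrow> y \<in> A \<Longrightarrow> f x y = - f y x"
      "\<And>x y. x \<in> A \<Longrightarrow> y \<in> A \<Longrightarrow> allowed (edge_mult G x y) (f x y)"
      "\<And>x. x \<in> A \<Longrightarrow> (\<Sum>y\<in>A. f x y) = q x"
      unfolding satisfiable_def by metis
    obtain k where k: "\<forall>e\<in>edges G. ends G e \<subseteq> A \<longrightarrow> k e \<in> ends G e"
      "\<forall>x\<in>A. (\<Sum>e\<in>{e \<in> incident_edges G x. ends G e \<subseteq> A}. sgn_at k x e) = (\<Sum>y\<in>A. f x y)"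
      using orient_pairs[OF wf AV f(1,2)] by blast
    have "\<exists>v. v \<in> ends G e \<and> part_of P v = h e" if "e \<in> edges K" for e using hin[OF that] by auto
    then obtain j where j: "\<And>e. e \<in> edges K \<Longrightarrow> j e \<in> ends G e \<and> part_of P (j e) = h e" by metis
    define H where "H e = (if ends G e \<subseteq> A then k e else j e)" for e
    have orient: "orientation_on G (edges G) H"
      using k(1) j by (auto simp: orientation_on_def H_def edgesK)
    have jx: "sgn_at H x e = sgn_at h (part_of P x) e" if "e \<in> edges K" "x \<in> ends G e" for x e
      using inj[OF that(1) _ that(2), of "j e"] j[OF that(1)] that edgesK by (auto simp: sgn_at_def H_def)
    have "balanced_at G \<beta> H x" if x: "x \<in> verts G" for x
    proof (cases "x \<in> A")
      case True
      have "(\<Sum>e\<in>incident_edges G x. sgn_at H x e) =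
        (\<Sum>e\<in>{e \<in> incident_edges G x. ends G e \<subseteq> A} \<union> out x. sgn_at H x e)"
        by (intro sum.cong) (auto simp: out_def)
      also have "\<dots> = (\<Sum>e\<in>{e \<in> incident_edges G x. ends G e \<subseteq> A}. sgn_at H x e) + (\<Sum>e\<in>out x. sgn_at H x e)"
        using finite_incident[OF wf, of x] by (intro sum.union_disjoint) (auto simp: out_def)
      also have "(\<Sum>e\<in>{e \<in> incident_edges G x. ends G e \<subseteq> A}. sgn_at H x e) =
         (\<Sum>e\<in>{e \<in> incident_edges G x. ends G e \<subseteq> A}. sgn_at k x e)"
        by (intro sum.cong) (auto simp: sgn_at_def H_def)
      also have "\<dots> = q x" using k(2) f(3)[OF True] True by simp
      also have "(\<Sum>e\<in>out x. sgn_at H x e) = (\<Sum>e\<in>out x. sgn_at h A e)"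
        using jx part_in[OF True] by (intro sum.cong) (auto simp: out_def incident_edges_def edgesK)
      finally show ?thesis using balanced_at_sgn[OF finite_incident[OF wf]] by (simp add: q_def)
    next
      case False
      have xP: "part_of P x = {x}" using part_out False x by simp
      have inc: "incident_edges K {x} = incident_edges G x"
      proof (intro equalityI subsetI)
        fix e assume "e \<in> incident_edges K {x}"
        then have e: "e \<in> edges G" "{x} \<in> part_of P ` ends G e" by (auto simp: incident_edges_def edgesK endsK)
        then obtain y where y: "y \<in> ends G e" "part_of P y = {x}" by auto
        then have "y = x" using part_in[of y] part_out[of y] endsG[OF e(1)] Asing[of x] by (cases "y \<in> A") auto
        then show "e \<in> incident_edges G x" using e y by (simp add: incident_edges_def)
      next
        fix e assume "e \<in> incident_edges G x"
        then show "e \<in> incident_edges K {x}" using False xP by (auto simp: incident_edges_def edgesK endsK)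
      qed
      have "(\<Sum>e\<in>incident_edges G x. sgn_at H x e) = (\<Sum>e\<in>incident_edges K {x}. sgn_at h {x} e)"
        unfolding inc
      proof (intro sum.cong refl)
        fix e assume "e \<in> incident_edges G x"
        then have "e \<in> edges K" "x \<in> ends G e" using False by (auto simp: incident_edges_def edgesK)
        then show "sgn_at H x e = sgn_at h {x} e" using jx xP by simp
      qed
      also have "\<dots> = \<beta> x" using bal[of "{x}"] False x by (simp add: P_def)
      finally show ?thesis using balanced_at_sgn[OF finite_incident[OF wf]] by simp
    qed
    moreover have "H e = \<psi> e" if e: "e \<in> incident_edges G z" for e
    proof -
      have eG: "e \<in> edges G" "z \<in> ends G e" using e by (auto simp: incident_edges_def)
      then have nA: "\<not> ends G e \<subseteq> A" using A by auto
      have eK: "e \<in> edges K" using eG nA edgesK by auto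
      have "part_of P z = {z}" using part_out[of z] z A by auto
      then have "{z} \<in> ends K e" using eG(2) unfolding endsK by (metis imageI)
      then have "e \<in> incident_edges K {z}" using eK by (simp add: incident_edges_def)
      then have "part_of P (j e) = part_of P (\<psi> e)" using agree j[OF eK] by (simp add: contract_orientation_def)
      moreover have "\<psi> e \<in> ends G e" using psi e by (auto simp: tip_preflow_def orientation_on_def)
      ultimately have "j e = \<psi> e" using inj[OF eK] j[OF eK] by auto
      then show ?thesis using nA by (simp add: H_def)
    qed
    ultimately have "extends_to_flow G \<beta> z \<psi>" using orient unfolding extends_to_flow_def nowhere_zero_flow_def by blast
    then show False using noext by simp
  qed
  then show ?thesis using q0 need unfolding locally_unsat_def by blast
qed

theorem mainTheorem2:
  fixes G :: "('v, 'e) multigraph" and \<beta> :: "'v \<Rightarrow> Z3" and z :: 'v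
  assumes "nontrivial_canvas G \<beta> z"
    and "flow_critical G \<beta> z"
    and "tame G \<beta> z"
  shows "\<forall>v \<in> verts G - {z}. int (degree G v) \<le> int (degree G z) - 2"
proof
  fix v assume v: "v \<in> verts G - {z}"
  have wf: "wf_multigraph G" and z: "z \<in> verts G" and card: "3 \<le> card (verts G)"
    using assms(1) by (auto simp: nontrivial_canvas_def canvas_def Z3_bordered_graph_def)
  have fin: "finite (verts G)" using wf by (simp add: wf_multigraph_def)
  define V where "V = verts G - {z}"
  have vV: "v \<in> V" using v by (simp add: V_def)
  have db: "degree_bound V (degree G) (\<Sum>x\<in>V. degree G x - (\<Sum>y\<in>V. edge_mult G x y))"
  proof (rule set_degree_bound_of_locally_unsat[OF wgraph_edge_mult])
    show "finite V" using fin by (simp add: V_def)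
    show "2 \<le> card V" using card z fin by (simp add: V_def card_Diff_singleton)
    show "locally_unsat (edge_mult G) (degree G) B" if "B \<subseteq> V" "2 \<le> card B" for B
      using locally_unsat_of_flow_critical[OF wf z assms(2,3)] that by (simp add: V_def)
  qed
  \<comment> \<open>Only edges at \<open>z\<close> leave \<open>V\<close>, so the boundary of
    \<open>V\<close> is the degree of the tip.\<close>
  have dz: "(\<Sum>x\<in>V. degree G x - (\<Sum>y\<in>V. edge_mult G x y)) = degree G z"
  proof -
    have "degree G x - (\<Sum>y\<in>V. edge_mult G x y) = edge_mult G z x" if "x \<in> V" for x
    proof -
      have "degree G x = edge_mult G x z + (\<Sum>y\<in>V. edge_mult G x y)"
        using degree_edge_mult[OF wf, of x] sum.remove[OF fin z, of "edge_mult G x"] that by (simp add: V_def)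
      moreover have "edge_mult G x z = edge_mult G z x" using wgraph_edge_mult[of G] unfolding wgraph_def by blast
      ultimately show ?thesis by simp
    qed
    moreover have "degree G z = (\<Sum>x\<in>V. edge_mult G z x)"
      using degree_edge_mult[OF wf z] sum.remove[OF fin z, of "edge_mult G z"] by (simp add: V_def edge_mult_def)
    ultimately show ?thesis by simp
  qed
  have "degree G v + 2 \<le> degree G z" using db vV unfolding dz degree_bound_def by blast
  then show "int (degree G v) \<le> int (degree G z) - 2" by linarith
qed

end
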